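(* Assume that there is a constant $C_B>0$ such that $\|\varphi\|_{H^1}\le C_B h^{-1}\|\varphi\|_{L^2}$ for all $h\in(0,1)$ and all $\varphi\in S_h$. Let $0<T<\infty$, $h\in(0,1)$ and $\psi_{0h}\in S_h$. Then, if the time discretization scale $\tau=T/N$ is sufficiently small (i.e. there is $\tau_0>0$, possibly depending on $h$, $\psi_{0h}$ and the other data, such that for all $N\in\mathbb{N}$ with $T/N\le\tau_0$), there exists a unique coherent fully discrete solution $\Psi\in S_h^{\times(N+1)}$ of the Hartree initial-boundary value problem with initial condition $\psi_{0h}$.
   Context: Setting: $\Omega\subset\mathbb{R}^d$ is a bounded domain with smooth boundary; $v\in C_0^\infty(\Omega,\mathbb{R})$, $\lambda\in C_0^\infty(\Omega,\mathbb{R})$, $V\in C_0^\infty(\mathbb{R}^d,\mathbb{R})$, where the subscript $0$ denotes compact support. All Lebesgue and Sobolev spaces are spaces of complex-valued functions over $\Omega$; $(\cdot,\cdot)_{L^2}$ is the $L^2$ scalar product, antilinear in the first and linear in the second argument. Define $g_V[\varphi](x):=\int_\Omega V(x-y)\varphi(y)\,dy$ and $f[\psi]:=\lambda\, g_V[|\psi|^2]\,\psi$. Galerkin spaces: $\{S_h\}_{h\in(0,1)}$ is a family of (complex) linear subspaces of $H^1_0$ with $S_h\subset C(\overline\Omega)\cap H_0^1$ and $\dim S_h=N_h<\infty$ for all $h\in(0,1)$. Time discretization: for $0<T<\infty$ and $N\in\mathbb{N}$, $N\ge1$, put $\tau:=T/N$. For $\Psi=(\Psi_0,\dots,\Psi_N)\in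 S_h^{\times(N+1)}$ and $n\in\{1,\dots,N\}$ put $\Psi_{n-1/2}:=\frac12(\Psi_n+\Psi_{n-1})$ and $\dot\Psi_n:=\frac1\tau(\Psi_n-\Psi_{n-1})$. $\Psi\in S_h^{\times(N+1)}$ is a coherent fully discrete solution with initial condition $\psi_{0h}\in S_h$ if $\Psi_0=\psi_{0h}$ and $$i(\varphi,\dot\Psi_n)_{L^2}=(\nabla\varphi,\nabla\Psi_{n-1/2})_{L^2}+(\varphi,v\Psi_{n-1/2})_{L^2}+(\varphi,f[\Psi_{n-1/2}])_{L^2}\quad\text{for all }\varphi\in S_h,\ n\in\{1,\dots,N\}.$$ *)

theory Defs
  imports "HOL-Analysis.Analysis" "HOL-Library.Function_Algebras"
begin

text \<open>
  A function on a subset of \<open>R^d\<close> is a total function on \<open>real^'d\<close>. The space \<open>R^d\<close> is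
  \<open>real^'d\<close>, with an arbitrary finite index type \<open>'d\<close>.
\<close>

section \<open>Smooth functions and domains\<close>

fun higher_differentiable_on ::
    "'a::real_normed_vector set \<Rightarrow> ('a \<Rightarrow> 'b::real_normed_vector) \<Rightarrow> nat \<Rightarrow> bool" where
  "higher_differentiable_on U f 0 \<longleftrightarrow> continuous_on U f"
| "higher_differentiable_on U f (Suc k) \<longleftrightarrow>
     (\<forall>x\<in>U. f differentiable (at x)) \<and>
     (\<forall>w. higher_differentiable_on U (\<lambda>x. frechet_derivative f (at x) w) k)"

text \<open>To be used for open \<open>U\<close> only.\<close>
definition smooth_on :: "'a::real_normed_vector set \<Rightarrow> ('a \<Rightarrow> 'b::real_normed_vector) \<Rightarrow> bool" where
  "smooth_on U f \<longleftrightarrow> (\<forall>k. higher_differentiable_on U f k)"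

text \<open>Compactly supported smooth functions on the open set \<open>U\<close>, extended by zero to the whole space.\<close>
definition test_functions :: "'a::real_normed_vector set \<Rightarrow> ('a \<Rightarrow> 'b::real_normed_vector) set" where
  "test_functions U =
     {f. smooth_on UNIV f \<and> compact (closure {x. f x \<noteq> 0}) \<and> closure {x. f x \<noteq> 0} \<subseteq> U}"

text \<open>
  The boundary is smooth if near each of its points a smooth diffeomorphism maps \<open>\<Omega>\<close>
  to a half space and the boundary to the bounding hyperplane.
\<close>
definition smooth_boundary :: "(real^'d) set \<Rightarrow> bool" where
  "smooth_boundary \<Omega> \<longleftrightarrow>
     (\<forall>p\<in>frontier \<Omega>. \<exists>U D \<Theta> \<Theta>' i.
        open U \<and> p \<in> U \<and> open (D :: (real^'d) set) \<and>
        homeomorphism U D \<Theta> \<Theta>' \<and> smooth_on U \<Theta> \<and> smooth_on D \<Theta>' \<and>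
        \<Theta> ` (U \<inter> \<Omega>) = {y\<in>D. y $ i > 0} \<and>
        \<Theta> ` (U \<inter> frontier \<Omega>) = {y\<in>D. y $ i = 0})"

definition smooth_bounded_domain :: "(real^'d) set \<Rightarrow> bool" where
  "smooth_bounded_domain \<Omega> \<longleftrightarrow>
     open \<Omega> \<and> connected \<Omega> \<and> \<Omega> \<noteq> {} \<and> bounded \<Omega> \<and> smooth_boundary \<Omega>"

section \<open>Lebesgue and Sobolev spaces\<close>

text \<open>Membership in the spaces below is a property of representatives, not of almost-everywhere classes.\<close>
definition L2_space :: "(real^'d) set \<Rightarrow> (real^'d \<Rightarrow> 'b::euclidean_space) set" where
  "L2_space \<Omega> =
     {u. u \<in> borel_measurable (lebesgue_on \<Omega>) \<and> integrable (lebesgue_on \<Omega>) (\<lambda>x. (norm (u x))\<^sup>2)}"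

definition L2_norm :: "(real^'d) set \<Rightarrow> (real^'d \<Rightarrow> 'b::euclidean_space) \<Rightarrow> real" where
  "L2_norm \<Omega> u = sqrt (\<integral>x. (norm (u x))\<^sup>2 \<partial>lebesgue_on \<Omega>)"

definition L2_inner :: "(real^'d) set \<Rightarrow> (real^'d \<Rightarrow> complex) \<Rightarrow> (real^'d \<Rightarrow> complex) \<Rightarrow> complex" where
  "L2_inner \<Omega> u w = (\<integral>x. cnj (u x) * w x \<partial>lebesgue_on \<Omega>)"

definition gradient :: "(real^'d \<Rightarrow> complex) \<Rightarrow> real^'d \<Rightarrow> complex^'d" where
  "gradient u x = (\<chi> i. frechet_derivative u (at x) (axis i 1))"

definition has_L2_weak_gradient ::
    "(real^'d) set \<Rightarrow> (real^'d \<Rightarrow> complex) \<Rightarrow> (real^'d \<Rightarrow> complex^'d) \<Rightarrow> bool" where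
  "has_L2_weak_gradient \<Omega> u G \<longleftrightarrow>
     G \<in> L2_space \<Omega> \<and>
     (\<forall>\<phi>\<in>test_functions \<Omega>. \<forall>i.
        (\<integral>x. u x * gradient \<phi> x $ i \<partial>lebesgue_on \<Omega>) = - (\<integral>x. G x $ i * \<phi> x \<partial>lebesgue_on \<Omega>))"

definition H1_space :: "(real^'d) set \<Rightarrow> (real^'d \<Rightarrow> complex) set" where
  "H1_space \<Omega> = {u \<in> L2_space \<Omega>. \<exists>G. has_L2_weak_gradient \<Omega> u G}"

text \<open>A representative of the weak gradient, which is unique up to null sets.\<close>
definition weak_gradient :: "(real^'d) set \<Rightarrow> (real^'d \<Rightarrow> complex) \<Rightarrow> real^'d \<Rightarrow> complex^'d" where
  "weak_gradient \<Omega> u = (SOME G. has_L2_weak_gradient \<Omega> u G)"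

definition H1_norm :: "(real^'d) set \<Rightarrow> (real^'d \<Rightarrow> complex) \<Rightarrow> real" where
  "H1_norm \<Omega> u = sqrt ((L2_norm \<Omega> u)\<^sup>2 + (L2_norm \<Omega> (weak_gradient \<Omega> u))\<^sup>2)"

text \<open>The closure of the test functions in the \<open>H\<^sup>1\<close> norm.\<close>
definition H10_space :: "(real^'d) set \<Rightarrow> (real^'d \<Rightarrow> complex) set" where
  "H10_space \<Omega> =
     {u \<in> H1_space \<Omega>. \<exists>\<phi>. (\<forall>n::nat. \<phi> n \<in> test_functions \<Omega>) \<and>
        (\<lambda>n. L2_norm \<Omega> (\<lambda>x. u x - \<phi> n x)) \<longlonglongrightarrow> 0 \<and>
        (\<lambda>n. L2_norm \<Omega> (\<lambda>x. weak_gradient \<Omega> u x - gradient (\<phi> n) x)) \<longlonglongrightarrow> 0}"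

definition gradient_inner ::
    "(real^'d) set \<Rightarrow> (real^'d \<Rightarrow> complex) \<Rightarrow> (real^'d \<Rightarrow> complex) \<Rightarrow> complex" where
  "gradient_inner \<Omega> u w =
     (\<Sum>i\<in>UNIV. L2_inner \<Omega> (\<lambda>x. weak_gradient \<Omega> u x $ i) (\<lambda>x. weak_gradient \<Omega> w x $ i))"

text \<open>
  Continuous functions on the closure of \<open>\<Omega>\<close>, extended by zero to the whole space. Since \<open>\<Omega>\<close> is
  open, two such functions are equal as soon as they agree almost everywhere in \<open>\<Omega>\<close>.
\<close>
definition C_closure :: "(real^'d) set \<Rightarrow> (real^'d \<Rightarrow> complex) set" where
  "C_closure \<Omega> = {u. continuous_on (closure \<Omega>) u \<and> (\<forall>x. x \<notin> closure \<Omega> \<longrightarrow> u x = 0)}"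

section \<open>Galerkin spaces and the fully discrete Hartree problem\<close>

definition cscale :: "complex \<Rightarrow> ('a \<Rightarrow> complex) \<Rightarrow> 'a \<Rightarrow> complex" where
  "cscale c u = (\<lambda>x. c * u x)"

lemma vector_space_cscale: "vector_space cscale"
  by unfold_locales (auto simp: cscale_def fun_eq_iff algebra_simps)

definition galerkin_space :: "(real^'d) set \<Rightarrow> (real^'d \<Rightarrow> complex) set \<Rightarrow> bool" where
  "galerkin_space \<Omega> S \<longleftrightarrow>
     module.subspace cscale S \<and> (\<exists>B. finite B \<and> module.span cscale B = S) \<and>
     S \<subseteq> C_closure \<Omega> \<inter> H10_space \<Omega>"

definition convolution_potential ::
    "(real^'d) set \<Rightarrow> (real^'d \<Rightarrow> real) \<Rightarrow> (real^'d \<Rightarrow> complex) \<Rightarrow> real^'d \<Rightarrow> complex" where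
  "convolution_potential \<Omega> V \<phi> x = (\<integral>y. complex_of_real (V (x - y)) * \<phi> y \<partial>lebesgue_on \<Omega>)"

definition hartree_term ::
    "(real^'d) set \<Rightarrow> (real^'d \<Rightarrow> real) \<Rightarrow> (real^'d \<Rightarrow> real) \<Rightarrow>
     (real^'d \<Rightarrow> complex) \<Rightarrow> real^'d \<Rightarrow> complex" where
  "hartree_term \<Omega> lam V \<psi> x =
     complex_of_real (lam x) *
     convolution_potential \<Omega> V (\<lambda>y. complex_of_real ((cmod (\<psi> y))\<^sup>2)) x * \<psi> x"

definition midpoint_value :: "(nat \<Rightarrow> 'a \<Rightarrow> complex) \<Rightarrow> nat \<Rightarrow> 'a \<Rightarrow> complex" where
  "midpoint_value \<Psi> n x = (\<Psi> n x + \<Psi> (n - 1) x) / 2"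

definition difference_quotient :: "real \<Rightarrow> (nat \<Rightarrow> 'a \<Rightarrow> complex) \<Rightarrow> nat \<Rightarrow> 'a \<Rightarrow> complex" where
  "difference_quotient \<tau> \<Psi> n x = (\<Psi> n x - \<Psi> (n - 1) x) / complex_of_real \<tau>"

text \<open>
  The tuple \<open>(\<Psi>\<^sub>0, \<dots>, \<Psi>\<^sub>N)\<close> is an extensional function on \<open>{0..N}\<close>, so equality of tuples is
  equality of functions. The time step is \<open>T / N\<close>.
\<close>
definition coherent_fully_discrete_solution ::
    "(real^'d) set \<Rightarrow> (real^'d \<Rightarrow> real) \<Rightarrow> (real^'d \<Rightarrow> real) \<Rightarrow> (real^'d \<Rightarrow> real) \<Rightarrow>
     (real^'d \<Rightarrow> complex) set \<Rightarrow> real \<Rightarrow> nat \<Rightarrow> (real^'d \<Rightarrow> complex) \<Rightarrow>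
     (nat \<Rightarrow> real^'d \<Rightarrow> complex) \<Rightarrow> bool" where
  "coherent_fully_discrete_solution \<Omega> v lam V S T N \<psi>\<^sub>0 \<Psi> \<longleftrightarrow>
     \<Psi> \<in> {0..N} \<rightarrow>\<^sub>E S \<and> \<Psi> 0 = \<psi>\<^sub>0 \<and>
     (\<forall>n\<in>{1..N}. \<forall>\<phi>\<in>S.
        \<i> * L2_inner \<Omega> \<phi> (difference_quotient (T / real N) \<Psi> n) =
          gradient_inner \<Omega> \<phi> (midpoint_value \<Psi> n)
          + L2_inner \<Omega> \<phi> (\<lambda>x. complex_of_real (v x) * midpoint_value \<Psi> n x)
          + L2_inner \<Omega> \<phi> (hartree_term \<Omega> lam V (midpoint_value \<Psi> n)))"

end

theory Submission imports Defs begin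

text \<open>
  Each time step of the coherent scheme is an implicit midpoint step in a finite-dimensional space
  with the \<open>L\<^sup>2\<close> inner product. It determines the midpoint \<open>\<xi>\<close> of the old state \<open>p\<close> and the new one by
  \<open>\<xi> = p - \<i> * \<tau> / 2 \<cdot> G \<xi>\<close>, where \<open>G \<xi>\<close> represents the right-hand side of the weak equation at \<open>\<xi>\<close>
  (\<open>riesz\<close>). On a Galerkin space, \<open>G\<close> is Lipschitz on bounded sets although it contains a gradient
  form and a cubic term: a finite orthonormal basis bounds the gradient form
  (\<open>sesquilinear_bounded\<close>) and bounds the sup norm by the \<open>L\<^sup>2\<close> norm, after which the Hartree term can
  be estimated pointwise (\<open>hartree_form_lipschitz\<close>). For small \<open>\<tau>\<close> the Banach fixed point theorem on a
  ball solves the step.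

  The Lipschitz constant depends on the size of the ball, so two points need an a priori bound: the
  number \<open>\<tau>\<^sub>0\<close> must serve all steps, and the solution must be unique in the whole space, not just
  in the ball. Both follow from conservation of mass (\<open>midpoint_step_nrm\<close>): testing the equation with
  the midpoint itself makes the right-hand side real, so a solution of the step has the \<open>L\<^sup>2\<close> norm of
  the old state. Hence all states have the norm of \<open>\<psi>\<^sub>0\<close>, and one ball suffices.

  The form behind \<open>G\<close> has to be sesquilinear in its gradient part, which is not immediate because the
  weak gradient is an arbitrary representative. On \<open>H\<^sup>1\<^sub>0\<close> gradients are limits of gradients of test
  functions, and this gives linearity almost everywhere (\<open>H10_weak_gradient_linear\<close>).
\<close>

section \<open>Finite-dimensional Hermitian spaces\<close>

text \<open>
  The space of unknowns is a finite-dimensional subspace of a vector space of functions. The form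
  \<open>ip\<close> is an inner product only on \<open>S\<close>: an integral over all functions is neither additive
  (integrability may fail) nor definite (functions may differ on a null set).
\<close>
locale hermitian_space = vector_space scale
  for scale :: "complex \<Rightarrow> 'b::ab_group_add \<Rightarrow> 'b" (infixr "\<cdot>" 75) +
  fixes S :: "'b set" and ip :: "'b \<Rightarrow> 'b \<Rightarrow> complex"
  assumes subspace_S: "subspace S"
    and finite_span: "\<exists>B. finite B \<and> span B = S"
    and ip_linear: "\<And>\<phi> u w c. \<phi> \<in> S \<Longrightarrow> u \<in> S \<Longrightarrow> w \<in> S \<Longrightarrow>
          ip \<phi> (u + c \<cdot> w) = ip \<phi> u + c * ip \<phi> w"
    and ip_cnj: "\<And>u w. u \<in> S \<Longrightarrow> w \<in> S \<Longrightarrow> ip u w = cnj (ip w u)"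
    and ip_pos: "\<And>u. u \<in> S \<Longrightarrow> u \<noteq> 0 \<Longrightarrow> 0 < Re (ip u u)"
begin

definition nrm :: "'b \<Rightarrow> real" where
  "nrm u = sqrt (Re (ip u u))"

lemma S_zero [simp]: "0 \<in> S"
  and S_add [simp]: "u \<in> S \<Longrightarrow> w \<in> S \<Longrightarrow> u + w \<in> S"
  and S_scale [simp]: "u \<in> S \<Longrightarrow> c \<cdot> u \<in> S"
  and S_diff [simp]: "u \<in> S \<Longrightarrow> w \<in> S \<Longrightarrow> u - w \<in> S"
  and S_sum: "(\<And>i. i \<in> I \<Longrightarrow> f i \<in> S) \<Longrightarrow> sum f I \<in> S"
  using subspace_S
  by (auto intro: subspace_0 subspace_add subspace_scale subspace_diff subspace_sum)

lemma linear_sum: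
  assumes lin: "\<And>u w c. u \<in> S \<Longrightarrow> w \<in> S \<Longrightarrow> l (u + c \<cdot> w) = l u + c * l w"
    and I: "finite I" "f ` I \<subseteq> S"
  shows "l (\<Sum>i\<in>I. c i \<cdot> f i) = (\<Sum>i\<in>I. c i * (l (f i) :: complex))"
proof -
  have "l 0 = 0" using lin[of 0 0 1] by simp
  with I show ?thesis
  proof (induction I)
    case (insert i I)
    have "(\<Sum>j\<in>I. c j \<cdot> f j) \<in> S" using insert.prems by (intro S_sum) auto
    then have "l ((\<Sum>j\<in>I. c j \<cdot> f j) + c i \<cdot> f i) = l (\<Sum>j\<in>I. c j \<cdot> f j) + c i * l (f i)"
      using insert.prems by (intro lin) auto
    then show ?case using insert by (simp add: add.commute)
  qed auto
qed

lemma ip_add: "\<phi> \<in> S \<Longrightarrow> u \<in> S \<Longrightarrow> w \<in> S \<Longrightarrow> ip \<phi> (u + w) = ip \<phi> u + ip \<phi> w"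
  using ip_linear[of \<phi> u w 1] by simp

lemma ip_zero [simp]: "\<phi> \<in> S \<Longrightarrow> ip \<phi> 0 = 0"
  using ip_add[of \<phi> 0 0] by simp

lemma ip_scale: "\<phi> \<in> S \<Longrightarrow> w \<in> S \<Longrightarrow> ip \<phi> (c \<cdot> w) = c * ip \<phi> w"
  using ip_linear[of \<phi> 0 w c] by simp

lemma ip_diff: "\<phi> \<in> S \<Longrightarrow> u \<in> S \<Longrightarrow> w \<in> S \<Longrightarrow> ip \<phi> (u - w) = ip \<phi> u - ip \<phi> w"
  using ip_linear[of \<phi> u w "-1"] by simp

lemma ip_sum:
  "\<phi> \<in> S \<Longrightarrow> finite I \<Longrightarrow> f ` I \<subseteq> S \<Longrightarrow> ip \<phi> (\<Sum>i\<in>I. c i \<cdot> f i) = (\<Sum>i\<in>I. c i * ip \<phi> (f i))"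
  by (intro linear_sum ip_linear) auto

lemma ip_add_left: "\<phi> \<in> S \<Longrightarrow> u \<in> S \<Longrightarrow> w \<in> S \<Longrightarrow> ip (u + w) \<phi> = ip u \<phi> + ip w \<phi>"
  by (metis S_add complex_cnj_add ip_add ip_cnj)

lemma ip_diff_left: "\<phi> \<in> S \<Longrightarrow> u \<in> S \<Longrightarrow> w \<in> S \<Longrightarrow> ip (u - w) \<phi> = ip u \<phi> - ip w \<phi>"
  by (metis S_diff complex_cnj_diff ip_diff ip_cnj)

lemma ip_scale_left: "\<phi> \<in> S \<Longrightarrow> w \<in> S \<Longrightarrow> ip (c \<cdot> w) \<phi> = cnj c * ip w \<phi>"
  by (metis S_scale complex_cnj_mult ip_scale ip_cnj)

lemma nrm_zero [simp]: "nrm 0 = 0"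
  by (simp add: nrm_def)

lemma Re_ip_nonneg: "u \<in> S \<Longrightarrow> 0 \<le> Re (ip u u)"
  by (cases "u = 0") (auto dest: ip_pos)

lemma nrm_nonneg [simp]: "u \<in> S \<Longrightarrow> 0 \<le> nrm u"
  by (simp add: nrm_def Re_ip_nonneg)

lemma nrm_pos: "u \<in> S \<Longrightarrow> u \<noteq> 0 \<Longrightarrow> 0 < nrm u"
  by (simp add: nrm_def ip_pos)

lemma nrm_eq_zero: "u \<in> S \<Longrightarrow> nrm u = 0 \<longleftrightarrow> u = 0"
  using nrm_pos[of u] by (cases "u = 0") auto

lemma ip_self: "u \<in> S \<Longrightarrow> ip u u = of_real ((nrm u)\<^sup>2)"
  using ip_cnj[of u u] Re_ip_nonneg[of u] by (simp add: complex_eq_iff nrm_def)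

lemma nrm_scale: "u \<in> S \<Longrightarrow> nrm (c \<cdot> u) = cmod c * nrm u"
proof -
  assume u: "u \<in> S"
  have "ip (c \<cdot> u) (c \<cdot> u) = (c * cnj c) * ip u u"
    using u by (simp add: ip_scale ip_scale_left)
  also have "\<dots> = of_real ((cmod c)\<^sup>2 * (nrm u)\<^sup>2)"
    using u by (simp add: ip_self complex_norm_square[symmetric] del: of_real_power)
  finally show ?thesis
    using u by (simp add: nrm_def[of "c \<cdot> u"] real_sqrt_mult)
qed

lemma nrm_commute: "u \<in> S \<Longrightarrow> w \<in> S \<Longrightarrow> nrm (u - w) = nrm (w - u)"
  using nrm_scale[of "w - u" "-1"] by simp

lemma cauchy_schwarz:
  assumes u: "u \<in> S" and w: "w \<in> S"
  shows "cmod (ip u w) \<le> nrm u * nrm w"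
proof (cases "u = 0")
  case True
  then show ?thesis using ip_cnj[of u w] u w by simp
next
  case False
  then have pos: "nrm u > 0" using u nrm_pos by simp
  define z where "z = ip u w"
  \<comment> \<open>\<open>a \<cdot> u\<close> is the projection of \<open>w\<close> onto \<open>u\<close>\<close>
  define a where "a = z / of_real ((nrm u)\<^sup>2)"
  have 1: "ip w u = cnj z" using u w ip_cnj z_def by blast
  have "ip (w - a \<cdot> u) (w - a \<cdot> u) = ip w w - a * cnj z - cnj a * z + cnj a * a * ip u u"
    using u w 1 by (simp add: ip_diff ip_diff_left ip_scale ip_scale_left z_def algebra_simps)
  also have "\<dots> = of_real ((nrm w)\<^sup>2 - (cmod z)\<^sup>2 / (nrm u)\<^sup>2)"
  proof -
    have zz: "z * cnj z = of_real ((cmod z)\<^sup>2)" by (simp add: complex_norm_square del: of_real_power)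
    have "a * cnj z = of_real ((cmod z)\<^sup>2 / (nrm u)\<^sup>2)" "cnj a * z = of_real ((cmod z)\<^sup>2 / (nrm u)\<^sup>2)"
      using zz by (simp_all add: a_def mult.commute)
    moreover from this have "cnj a * a * ip u u = of_real ((cmod z)\<^sup>2 / (nrm u)\<^sup>2)"
      using pos u by (simp add: a_def ip_self field_simps power4_eq_xxxx power2_eq_square)
    ultimately show ?thesis using w by (simp add: ip_self)
  qed
  finally have "0 \<le> (nrm w)\<^sup>2 - (cmod z)\<^sup>2 / (nrm u)\<^sup>2"
    using Re_ip_nonneg[of "w - a \<cdot> u"] u w by simp
  then have "(cmod z)\<^sup>2 \<le> (nrm u * nrm w)\<^sup>2"
    using pos by (simp add: field_simps)
  then show ?thesis
    using u w unfolding z_def by - (rule power2_le_imp_le, simp_all)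
qed

lemma nrm_add_sq:
  "u \<in> S \<Longrightarrow> w \<in> S \<Longrightarrow> (nrm (u + w))\<^sup>2 = (nrm u)\<^sup>2 + 2 * Re (ip u w) + (nrm w)\<^sup>2"
proof -
  assume u: "u \<in> S" and w: "w \<in> S"
  have "ip (u + w) (u + w) = ip u u + (ip u w + cnj (ip u w)) + ip w w"
    using u w ip_cnj[of w u] by (simp add: ip_add ip_add_left)
  then show ?thesis
    using u w Re_ip_nonneg[of "u + w"] Re_ip_nonneg[of u] Re_ip_nonneg[of w]
    by (simp add: nrm_def)
qed

lemma nrm_triangle: "u \<in> S \<Longrightarrow> w \<in> S \<Longrightarrow> nrm (u + w) \<le> nrm u + nrm w"
proof -
  assume u: "u \<in> S" and w: "w \<in> S"
  have "Re (ip u w) \<le> nrm u * nrm w"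
    using cauchy_schwarz[OF u w] complex_Re_le_cmod[of "ip u w"] by linarith
  then have "(nrm (u + w))\<^sup>2 \<le> (nrm u + nrm w)\<^sup>2"
    unfolding nrm_add_sq[OF u w] power2_sum by linarith
  then show ?thesis
    using u w by - (rule power2_le_imp_le, simp_all)
qed

lemma nrm_sum_le: "finite I \<Longrightarrow> f ` I \<subseteq> S \<Longrightarrow> nrm (\<Sum>i\<in>I. f i) \<le> (\<Sum>i\<in>I. nrm (f i))"
proof (induction I rule: finite_induct)
  case (insert i I)
  then have "nrm (f i + sum f I) \<le> nrm (f i) + nrm (sum f I)"
    by (intro nrm_triangle S_sum) auto
  then show ?case using insert by simp
qed simp

definition orthonormal :: "'b set \<Rightarrow> bool" where
  "orthonormal E \<longleftrightarrow> finite E \<and> E \<subseteq> S \<and>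
     (\<forall>e\<in>E. \<forall>e'\<in>E. ip e e' = (if e = e' then 1 else 0))"

definition proj :: "'b set \<Rightarrow> 'b \<Rightarrow> 'b" where
  "proj E u = (\<Sum>e\<in>E. ip e u \<cdot> e)"

lemma orthonormalD:
  assumes "orthonormal E"
  shows "finite E" "E \<subseteq> S" "e \<in> E \<Longrightarrow> e \<in> S" "e \<in> E \<Longrightarrow> ip e e = 1"
    "e \<in> E \<Longrightarrow> e' \<in> E \<Longrightarrow> e \<noteq> e' \<Longrightarrow> ip e e' = 0" "e \<in> E \<Longrightarrow> nrm e = 1"
  using assms by (auto simp: orthonormal_def nrm_def)

lemma proj_in_S: "orthonormal E \<Longrightarrow> proj E u \<in> S"
  unfolding proj_def using orthonormalD by (intro S_sum) auto

lemma ip_proj: "orthonormal E \<Longrightarrow> \<phi> \<in> S \<Longrightarrow> ip \<phi> (proj E u) = (\<Sum>e\<in>E. ip e u * ip \<phi> e)"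
  unfolding proj_def using ip_sum[of \<phi> E "\<lambda>e. e" "\<lambda>e. ip e u"] orthonormalD by simp

lemma ip_proj_basis:
  assumes E: "orthonormal E" and e: "e \<in> E"
  shows "ip e (proj E u) = ip e u"
proof -
  have "ip e (proj E u) = (\<Sum>e'\<in>E. if e = e' then ip e' u else 0)"
    unfolding ip_proj[OF E orthonormalD(3)[OF E e]]
    using orthonormalD[OF E] e by (intro sum.cong) auto
  then show ?thesis using orthonormalD(1)[OF E] e by simp
qed

text \<open>
  Remove from the next vector \<open>b\<close> its projection onto the span of \<open>E\<close>; the residual \<open>r\<close> is orthogonal
  to \<open>E\<close>. Either it vanishes and \<open>E\<close> already represents \<open>b\<close>, or normalizing it extends \<open>E\<close>.
\<close>
lemma gram_schmidt:
  assumes "finite B" "B \<subseteq> S"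
  shows "\<exists>E. orthonormal E \<and> (\<forall>b\<in>B. proj E b = b)"
  using assms
proof (induction B rule: finite_induct)
  case empty
  then show ?case by (intro exI[of _ "{}"]) (auto simp: orthonormal_def)
next
  case (insert b B)
  then have b: "b \<in> S" and BS: "B \<subseteq> S" by auto
  then obtain E where E: "orthonormal E" "\<And>b. b \<in> B \<Longrightarrow> proj E b = b"
    using insert.IH by auto
  define r where "r = b - proj E b"
  have r: "r \<in> S" unfolding r_def using b proj_in_S[OF E(1)] by simp
  have er: "ip e r = 0" if e: "e \<in> E" for e
    using ip_proj_basis[OF E(1) e] orthonormalD(3)[OF E(1) e] b proj_in_S[OF E(1)]
    by (simp add: r_def ip_diff)
  show ?case
  proof (cases "r = 0")
    case True
    then show ?thesis using E by (intro exI[of _ E]) (auto simp: r_def)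
  next
    case False
    then have pos: "nrm r > 0" using r nrm_pos by simp
    define e0 where "e0 = of_real (inverse (nrm r)) \<cdot> r"
    have e0: "e0 \<in> S" using r by (simp add: e0_def)
    have ee0: "ip e e0 = 0" if "e \<in> E" for e
      using that er orthonormalD(3)[OF E(1)] r by (simp add: e0_def ip_scale)
    have e0e: "ip e0 e = 0" if "e \<in> E" for e
      using ee0[OF that] ip_cnj[of e0 e] e0 orthonormalD(3)[OF E(1) that] by simp
    have e0e0: "ip e0 e0 = 1"
      using pos r by (simp add: e0_def ip_scale ip_scale_left ip_self[OF r] power2_eq_square field_simps)
    have notin: "e0 \<notin> E" using e0e e0e0 by fastforce
    have e0p: "ip e0 (proj E u) = 0" for u
      using e0e by (simp add: ip_proj[OF E(1) e0])
    have ins: "proj (insert e0 E) u = ip e0 u \<cdot> e0 + proj E u" for u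
      using notin orthonormalD(1)[OF E(1)] by (simp add: proj_def)
    have "ip e0 b = ip e0 (r + proj E b)" by (simp add: r_def)
    also have "\<dots> = of_real (nrm r)"
      using e0 r e0p proj_in_S[OF E(1)] pos
      by (simp add: ip_add e0_def ip_scale_left ip_self[OF r] power2_eq_square)
    finally have "ip e0 b \<cdot> e0 = r" using pos by (simp add: e0_def)
    then have "proj (insert e0 E) b = b" by (simp add: ins r_def)
    moreover have "proj (insert e0 E) b' = b'" if "b' \<in> B" for b'
      using E(2)[OF that] e0p[of b'] by (simp add: ins)
    moreover have "orthonormal (insert e0 E)"
      using E(1) e0 ee0 e0e e0e0 unfolding orthonormal_def by auto
    ultimately show ?thesis by blast
  qed
qed

text \<open>
  A subspace that contains a spanning set is everything, and the vectors which are reproduced by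
  their Fourier expansion form a subspace. Coordinates with respect to such a set \<open>E\<close> replace the
  equivalence of norms, completeness and duality of finite-dimensional spaces below.
\<close>
lemma orthonormal_basis:
  obtains E where "orthonormal E" "\<And>u. u \<in> S \<Longrightarrow> proj E u = u"
proof -
  obtain B where B: "finite B" "span B = S" using finite_span by blast
  then have BS: "B \<subseteq> S" using span_superset by blast
  obtain E where E: "orthonormal E" "\<And>b. b \<in> B \<Longrightarrow> proj E b = b"
    using gram_schmidt[OF B(1) BS] by auto
  have "subspace {u \<in> S. proj E u = u}"
  proof (rule subspaceI)
    show "0 \<in> {u \<in> S. proj E u = u}"
      using orthonormalD(3)[OF E(1)] by (simp add: proj_def)
  next
    fix u w assume uw: "u \<in> {u \<in> S. proj E u = u}" "w \<in> {u \<in> S. proj E u = u}"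
    then have "proj E (u + w) = proj E u + proj E w"
      unfolding proj_def sum.distrib[symmetric] using orthonormalD(3)[OF E(1)]
      by (intro sum.cong) (auto simp: ip_add scale_left_distrib)
    with uw show "u + w \<in> {u \<in> S. proj E u = u}" by auto
  next
    fix c u assume u: "u \<in> {u \<in> S. proj E u = u}"
    then have "proj E (c \<cdot> u) = c \<cdot> proj E u"
      unfolding proj_def scale_sum_right using orthonormalD(3)[OF E(1)]
      by (intro sum.cong) (auto simp: ip_scale)
    with u show "c \<cdot> u \<in> {u \<in> S. proj E u = u}" by auto
  qed
  moreover have "B \<subseteq> {u \<in> S. proj E u = u}" using BS E(2) by auto
  ultimately have "S \<subseteq> {u \<in> S. proj E u = u}" using B(2) span_minimal by blast
  then show thesis using E(1) that by blast
qed

lemma coordinate_bound: "orthonormal E \<Longrightarrow> e \<in> E \<Longrightarrow> u \<in> S \<Longrightarrow> cmod (ip e u) \<le> nrm u"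
  using cauchy_schwarz[of e u] orthonormalD(3,6)[of E e] by simp

lemma linear_proj:
  assumes "orthonormal E" "u \<in> S" "proj E u = u"
    and lin: "\<And>u w c. u \<in> S \<Longrightarrow> w \<in> S \<Longrightarrow> l (u + c \<cdot> w) = l u + c * l w"
  shows "l u = (\<Sum>e\<in>E. ip e u * (l e :: complex))"
  using linear_sum[of l E "\<lambda>e. e" "\<lambda>e. ip e u"] assms orthonormalD[of E]
  by (simp add: proj_def)

lemma linear_bounded:
  assumes E: "orthonormal E" "proj E u = u" and u: "u \<in> S"
    and lin: "\<And>u w c. u \<in> S \<Longrightarrow> w \<in> S \<Longrightarrow> l (u + c \<cdot> w) = l u + c * l w"
  shows "cmod (l u) \<le> (\<Sum>e\<in>E. cmod (l e)) * nrm u"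
proof -
  have "l u = (\<Sum>e\<in>E. ip e u * l e)" using lin by (intro linear_proj E u)
  also have "cmod \<dots> \<le> (\<Sum>e\<in>E. nrm u * cmod (l e))"
    using coordinate_bound[OF E(1) _ u]
    by (intro sum_norm_le) (auto simp: norm_mult intro!: mult_right_mono)
  finally show ?thesis by (simp add: sum_distrib_left mult.commute)
qed

text \<open>
  Boundedness by finite dimension: expand both arguments in an orthonormal basis. This is how the
  gradient form, which involves derivatives, is controlled by the \<open>L\<^sup>2\<close> norm on a Galerkin space.
\<close>
lemma sesquilinear_bounded:
  assumes lin: "\<And>\<phi> u w c. \<phi> \<in> S \<Longrightarrow> u \<in> S \<Longrightarrow> w \<in> S \<Longrightarrow> a \<phi> (u + c \<cdot> w) = a \<phi> u + c * a \<phi> w"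
    and cnj: "\<And>u w. u \<in> S \<Longrightarrow> w \<in> S \<Longrightarrow> a u w = cnj (a w u)"
  obtains C where "C \<ge> 0" "\<And>\<phi> u. \<phi> \<in> S \<Longrightarrow> u \<in> S \<Longrightarrow> cmod (a \<phi> u) \<le> C * nrm \<phi> * nrm u"
proof -
  obtain E where E: "orthonormal E" "\<And>u. u \<in> S \<Longrightarrow> proj E u = u" using orthonormal_basis by auto
  have right: "cmod (a \<phi> u) \<le> (\<Sum>e\<in>E. cmod (a \<phi> e)) * nrm u" if "\<phi> \<in> S" "u \<in> S" for \<phi> u
    using that E lin by (intro linear_bounded) auto
  define C where "C = (\<Sum>e\<in>E. \<Sum>e'\<in>E. cmod (a e e'))"
  show thesis
  proof
    show "C \<ge> 0" by (simp add: C_def sum_nonneg)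
    fix \<phi> u assume \<phi>: "\<phi> \<in> S" and u: "u \<in> S"
    have "cmod (a \<phi> e) \<le> (\<Sum>e'\<in>E. cmod (a e e')) * nrm \<phi>" if "e \<in> E" for e
      using right[of e \<phi>] cnj[of \<phi>] \<phi> orthonormalD(3)[OF E(1)] that by simp
    then have "(\<Sum>e\<in>E. cmod (a \<phi> e)) \<le> C * nrm \<phi>"
      unfolding C_def sum_distrib_right by (intro sum_mono) (simp add: sum_distrib_right)
    then show "cmod (a \<phi> u) \<le> C * nrm \<phi> * nrm u"
      using right[OF \<phi> u] mult_right_mono[of _ _ "nrm u"] u by (meson nrm_nonneg order_trans)
  qed
qed

text \<open>
  The representing vector has the values of the functional on an orthonormal basis as coordinates.
  The functional is antilinear because \<open>ip\<close> is antilinear in the argument that varies.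
\<close>
lemma riesz:
  assumes lin: "\<And>u w c. u \<in> S \<Longrightarrow> w \<in> S \<Longrightarrow> l (u + c \<cdot> w) = l u + cnj c * l w"
  obtains g where "g \<in> S" "\<And>\<phi>. \<phi> \<in> S \<Longrightarrow> ip \<phi> g = l \<phi>"
proof -
  obtain E where E: "orthonormal E" "\<And>u. u \<in> S \<Longrightarrow> proj E u = u" using orthonormal_basis by auto
  show thesis
  proof
    show "(\<Sum>e\<in>E. l e \<cdot> e) \<in> S" using orthonormalD[OF E(1)] by (intro S_sum) auto
    fix \<phi> assume \<phi>: "\<phi> \<in> S"
    have "cnj (l \<phi>) = (\<Sum>e\<in>E. ip e \<phi> * cnj (l e))"
      using lin by (intro linear_proj E \<phi>) simp
    also have "\<dots> = cnj (\<Sum>e\<in>E. l e * ip \<phi> e)"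
      unfolding cnj_sum using orthonormalD(3)[OF E(1)] \<phi> ip_cnj[of _ \<phi>]
      by (intro sum.cong) auto
    also have "(\<Sum>e\<in>E. l e * ip \<phi> e) = ip \<phi> (\<Sum>e\<in>E. l e \<cdot> e)"
      using ip_sum[of \<phi> E "\<lambda>e. e" l] orthonormalD[OF E(1)] \<phi> by simp
    finally show "ip \<phi> (\<Sum>e\<in>E. l e \<cdot> e) = l \<phi>" by simp
  qed
qed

text \<open>
  Banach's theorem, applied to the ball with the metric of \<open>nrm\<close>. The ball is complete since the
  coordinates of a Cauchy sequence converge, and these determine the vector.
\<close>
lemma ball_contraction_fixpoint:
  assumes R: "R \<ge> 0" and k: "k < 1"
    and f: "\<And>u. u \<in> S \<Longrightarrow> nrm u \<le> R \<Longrightarrow> f u \<in> S \<and> nrm (f u) \<le> R"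
    and con: "\<And>u w. u \<in> S \<Longrightarrow> nrm u \<le> R \<Longrightarrow> w \<in> S \<Longrightarrow> nrm w \<le> R \<Longrightarrow>
                nrm (f u - f w) \<le> k * nrm (u - w)"
  obtains u where "u \<in> S" "nrm u \<le> R" "f u = u"
proof -
  define M where "M = {u \<in> S. nrm u \<le> R}"
  \<comment> \<open>outside \<open>S\<close> the map \<open>nrm\<close> need not be symmetric or nonnegative, which a metric must be everywhere\<close>
  define d where "d u w = (if u \<in> S \<and> w \<in> S then nrm (u - w) else 0)" for u w
  interpret Metric_space M d
  proof
    show "d x z \<le> d x y + d y z" if "x \<in> M" "y \<in> M" "z \<in> M" for x y z
      using nrm_triangle[of "x - y" "y - z"] that by (auto simp: d_def M_def)
  qed (auto simp: d_def nrm_commute M_def nrm_eq_zero)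
  have mcomplete
    unfolding mcomplete_def
  proof (intro allI impI)
    fix s assume s: "MCauchy s"
    have "range s \<subseteq> M" using s by (simp add: MCauchy_def)
    then have sS: "s n \<in> S" and sR: "nrm (s n) \<le> R" for n by (auto simp: M_def)
    have Cau: "\<exists>N. \<forall>m\<ge>N. \<forall>n\<ge>N. nrm (s m - s n) < \<epsilon>" if "\<epsilon> > 0" for \<epsilon>
      using s that sS by (simp add: MCauchy_def d_def)
    obtain E where E: "orthonormal E" "\<And>u. u \<in> S \<Longrightarrow> proj E u = u" using orthonormal_basis by auto
    have "\<exists>c. (\<lambda>n. ip e (s n)) \<longlonglongrightarrow> c" if e: "e \<in> E" for e
    proof -
      have "cmod (ip e (s m) - ip e (s n)) \<le> nrm (s m - s n)" for m n
        using coordinate_bound[OF E(1) e, of "s m - s n"] orthonormalD(3)[OF E(1) e] sS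
        by (simp add: ip_diff)
      then have "Cauchy (\<lambda>n. ip e (s n))"
        using Cau by (intro metric_CauchyI) (metis dist_norm order_le_less_trans)
      then show ?thesis by (simp add: Cauchy_convergent_iff convergent_def)
    qed
    then obtain c where c: "\<And>e. e \<in> E \<Longrightarrow> (\<lambda>n. ip e (s n)) \<longlonglongrightarrow> c e" by metis
    define x where "x = (\<Sum>e\<in>E. c e \<cdot> e)"
    have x: "x \<in> S" unfolding x_def using orthonormalD[OF E(1)] by (intro S_sum) auto
    have bound: "nrm (s n - x) \<le> (\<Sum>e\<in>E. cmod (ip e (s n) - c e))" for n
    proof -
      have "s n - x = proj E (s n) - x" using E(2)[OF sS[of n]] by simp
      also have "\<dots> = (\<Sum>e\<in>E. (ip e (s n) - c e) \<cdot> e)"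
        by (simp add: x_def proj_def sum_subtractf scale_left_diff_distrib)
      also have "nrm \<dots> \<le> (\<Sum>e\<in>E. nrm ((ip e (s n) - c e) \<cdot> e))"
        using orthonormalD[OF E(1)] by (intro nrm_sum_le) auto
      also have "\<dots> = (\<Sum>e\<in>E. cmod (ip e (s n) - c e))"
        using orthonormalD[OF E(1)] by (intro sum.cong) (auto simp: nrm_scale)
      finally show ?thesis .
    qed
    have "(\<lambda>n. \<Sum>e\<in>E. cmod (ip e (s n) - c e)) \<longlonglongrightarrow> (\<Sum>e\<in>E. 0)"
      using c by (intro tendsto_sum) (simp add: tendsto_norm_zero_iff LIM_zero_iff)
    then have sum0: "(\<lambda>n. \<Sum>e\<in>E. cmod (ip e (s n) - c e)) \<longlonglongrightarrow> 0" by simp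
    have lim: "(\<lambda>n. nrm (s n - x)) \<longlonglongrightarrow> 0"
      by (rule tendsto_sandwich[OF _ _ tendsto_const sum0]) (use bound sS x in auto)
    have "nrm x \<le> R + nrm (s n - x)" for n
    proof -
      have "nrm (s n + (x - s n)) \<le> nrm (s n) + nrm (x - s n)"
        using sS x by (intro nrm_triangle) auto
      then have "nrm x \<le> nrm (s n) + nrm (x - s n)" by simp
      then show ?thesis using sR[of n] nrm_commute[OF x sS[of n]] by linarith
    qed
    then have "nrm x \<le> R"
      using tendsto_lowerbound[of "\<lambda>n. R + nrm (s n - x)" R sequentially "nrm x"]
        tendsto_add[OF tendsto_const lim, of R] by simp
    moreover have "\<exists>N. \<forall>n\<ge>N. nrm (s n - x) < \<epsilon>" if "\<epsilon> > 0" for \<epsilon>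
    proof -
      from lim that have "\<exists>N. \<forall>n\<ge>N. norm (nrm (s n - x) - 0) < \<epsilon>" by (rule LIMSEQ_D)
      then show ?thesis by (simp add: sS x)
    qed
    ultimately show "\<exists>x. limitin mtopology s x sequentially"
      unfolding limit_metric_sequentially using x sS sR
      by (intro exI[of _ x]) (auto simp: M_def d_def)
  qed
  moreover have "0 \<in> M" using R by (simp add: M_def)
  moreover have "f \<in> M \<rightarrow> M" using f by (auto simp: M_def)
  moreover have "d (f u) (f w) \<le> k * d u w" if "u \<in> M" "w \<in> M" for u w
    using con f that by (auto simp: M_def d_def)
  ultimately obtain u where "u \<in> M" "f u = u"
    using k by (rule_tac Banach_fixedpoint_thm[of f k]) auto
  then show thesis using that by (auto simp: M_def)
qed

section \<open>The implicit midpoint rule\<close>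

definition midpoint_step :: "('b \<Rightarrow> 'b \<Rightarrow> complex) \<Rightarrow> real \<Rightarrow> 'b \<Rightarrow> 'b \<Rightarrow> bool" where
  "midpoint_step F \<tau> p u \<longleftrightarrow>
     (\<forall>\<phi>\<in>S. \<i> * ip \<phi> (of_real (inverse \<tau>) \<cdot> (u - p)) = F \<phi> ((1 / 2) \<cdot> (u + p)))"

text \<open>
  Conservation of mass. Testing with the midpoint \<open>\<xi>\<close> makes the right-hand side real, hence
  \<open>Re (ip (u + p) (u - p)) = 0\<close>, and this real part is the difference of the squared norms of \<open>u\<close> and \<open>p\<close>.
\<close>
lemma midpoint_step_nrm:
  assumes S: "p \<in> S" "u \<in> S" and \<tau>: "\<tau> > 0"
    and real: "\<And>u. u \<in> S \<Longrightarrow> Im (F u u) = 0"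
    and step: "midpoint_step F \<tau> p u"
  shows "nrm u = nrm p"
proof -
  define \<xi> where "\<xi> = (1 / 2) \<cdot> (u + p)"
  have \<xi>: "\<xi> \<in> S" using S by (simp add: \<xi>_def)
  have "\<i> * ip \<xi> (of_real (inverse \<tau>) \<cdot> (u - p)) = F \<xi> \<xi>"
    using step \<xi> unfolding midpoint_step_def \<xi>_def by blast
  moreover have "ip \<xi> (of_real (inverse \<tau>) \<cdot> (u - p)) = of_real (inverse \<tau>) * ((1/2) * ip (u + p) (u - p))"
    using S \<xi> by (simp add: ip_scale \<xi>_def ip_scale_left)
  ultimately have "Im (\<i> * (of_real (inverse \<tau>) * ((1/2) * ip (u + p) (u - p)))) = 0"
    using real \<xi> by metis
  then have "Re (ip (u + p) (u - p)) = 0" using \<tau> by simp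
  moreover have "ip (u + p) (u - p) = ip u u - ip p p + (ip p u - cnj (ip p u))"
    using S ip_cnj[of u p] by (simp add: ip_add_left ip_diff)
  ultimately show ?thesis by (simp add: nrm_def)
qed

text \<open>
  In terms of the midpoint \<open>\<xi>\<close> and the Riesz representative \<open>G \<xi>\<close> of \<open>\<lambda>\<phi>. F \<phi> \<xi>\<close>, the step from \<open>p\<close>
  is the fixed point equation \<open>\<xi> = p - \<i> * \<tau> / 2 \<cdot> G \<xi>\<close>. The Lipschitz constant \<open>L\<close> of \<open>F\<close> is only
  available on a ball of radius \<open>R\<close>. The radius exceeds the norm of \<open>p\<close> by 1, so for small \<open>\<tau>\<close> the map
  sends the ball into itself and contracts it, which gives a solution. For uniqueness among all of
  \<open>S\<close>, conservation of mass gives the a priori bound that puts every midpoint into the ball.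
\<close>
lemma midpoint_step_ex1:
  assumes S: "p \<in> S" and R: "nrm p + 1 \<le> R" and \<tau>: "\<tau> > 0" "\<tau> * L * R \<le> 1" and L: "L \<ge> 0"
    and anti: "\<And>u w \<xi> c. u \<in> S \<Longrightarrow> w \<in> S \<Longrightarrow> \<xi> \<in> S \<Longrightarrow> F (u + c \<cdot> w) \<xi> = F u \<xi> + cnj c * F w \<xi>"
    and real: "\<And>u. u \<in> S \<Longrightarrow> Im (F u u) = 0"
    and zero: "\<And>\<phi>. \<phi> \<in> S \<Longrightarrow> F \<phi> 0 = 0"
    and lip: "\<And>\<phi> u w. \<phi> \<in> S \<Longrightarrow> u \<in> S \<Longrightarrow> w \<in> S \<Longrightarrow> nrm u \<le> R \<Longrightarrow> nrm w \<le> R \<Longrightarrow>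
                cmod (F \<phi> u - F \<phi> w) \<le> L * nrm \<phi> * nrm (u - w)"
  shows "\<exists>!u. u \<in> S \<and> midpoint_step F \<tau> p u"
proof -
  have "\<exists>g. g \<in> S \<and> (\<forall>\<phi>\<in>S. ip \<phi> g = F \<phi> \<xi>)" if "\<xi> \<in> S" for \<xi>
    using riesz[of "\<lambda>u. F u \<xi>"] anti that by metis
  then obtain G where G: "\<And>\<xi>. \<xi> \<in> S \<Longrightarrow> G \<xi> \<in> S"
    "\<And>\<phi> \<xi>. \<phi> \<in> S \<Longrightarrow> \<xi> \<in> S \<Longrightarrow> ip \<phi> (G \<xi>) = F \<phi> \<xi>" by metis
  have R1: "R \<ge> 1" using R nrm_nonneg[OF S] by linarith
  have \<tau>L: "\<tau> * L \<le> 1"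
  proof -
    have "\<tau> * L * 1 \<le> \<tau> * L * R" using \<tau> L R1 by (intro mult_left_mono) auto
    then show ?thesis using \<tau> by linarith
  qed
  \<comment> \<open>test the representative of the difference with itself\<close>
  have Glip: "nrm (G u - G w) \<le> L * nrm (u - w)"
    if "u \<in> S" "w \<in> S" "nrm u \<le> R" "nrm w \<le> R" for u w
  proof -
    define D where "D = G u - G w"
    have D: "D \<in> S" using G that by (simp add: D_def)
    have "of_real ((nrm D)\<^sup>2) = ip D D" using D by (simp add: ip_self)
    also have "\<dots> = ip D (G u - G w)" by (simp add: D_def)
    also have "\<dots> = F D u - F D w" using D G that by (simp add: ip_diff)
    finally have "(nrm D)\<^sup>2 = cmod (F D u - F D w)"
      by (metis abs_of_nonneg norm_of_real zero_le_power2)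
    also have "\<dots> \<le> L * nrm D * nrm (u - w)" using lip D that by blast
    finally have "nrm D * nrm D \<le> nrm D * (L * nrm (u - w))"
      by (simp add: power2_eq_square algebra_simps)
    then show ?thesis
      unfolding D_def[symmetric] using nrm_nonneg[OF D] L nrm_nonneg[of "u - w"] that
      by (cases "nrm D = 0") (auto simp: mult_le_cancel_left)
  qed
  have G0: "G 0 = 0"
    using G(1)[OF S_zero] G(2)[OF G(1)[OF S_zero] S_zero] zero[of "G 0"] ip_pos[of "G 0"] by fastforce
  define f where "f \<xi> = p - (\<i> * of_real (\<tau> / 2)) \<cdot> G \<xi>" for \<xi>
  have c: "cmod (\<i> * of_real (\<tau> / 2)) = \<tau> / 2" using \<tau> by (simp add: norm_mult)
  have fS: "f \<xi> \<in> S" if "\<xi> \<in> S" for \<xi> using S G that by (simp add: f_def)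
  have fcon: "nrm (f u - f w) \<le> 1/2 * nrm (u - w)"
    if "u \<in> S" "w \<in> S" "nrm u \<le> R" "nrm w \<le> R" for u w
  proof -
    have "f u - f w = (\<i> * of_real (\<tau> / 2)) \<cdot> (G w - G u)"
      by (simp add: f_def scale_right_diff_distrib)
    then have "nrm (f u - f w) = \<tau> / 2 * nrm (G w - G u)"
      using nrm_scale[of "G w - G u" "\<i> * of_real (\<tau> / 2)"] G that c by simp
    also have "\<dots> \<le> \<tau> / 2 * (L * nrm (u - w))"
      using \<tau> Glip[of w u] that nrm_commute[of u w] by simp
    also have "\<dots> \<le> 1/2 * nrm (u - w)"
      using mult_right_mono[OF \<tau>L, of "nrm (u - w)"] that by simp
    finally show ?thesis .
  qed
  have f0: "f 0 = p" by (simp add: f_def G0)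
  have fR: "nrm (f u) \<le> R" if "u \<in> S" "nrm u \<le> R" for u
  proof -
    have "f u - f 0 = (- (\<i> * of_real (\<tau> / 2))) \<cdot> (G u - G 0)"
      by (simp add: f_def G0)
    then have "nrm (f u - f 0) = \<tau> / 2 * nrm (G u - G 0)"
      using nrm_scale[of "G u - G 0" "- (\<i> * of_real (\<tau> / 2))"] G that c by simp
    also have "\<dots> \<le> \<tau> / 2 * (L * R)"
      using \<tau> Glip[of u 0] that R1 L mult_left_mono[of "nrm u" R L]
      by (intro mult_left_mono) auto
    also have "\<dots> \<le> 1" using \<tau> by simp
    finally have "nrm (f u - p) \<le> 1" by (simp add: f0)
    then show ?thesis
      using nrm_triangle[of p "f u - p"] S fS[OF that(1)] R by simp
  qed
  \<comment> \<open>the change of variables \<open>u = 2 \<cdot> \<xi> - p\<close>\<close>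
  have step_iff: "midpoint_step F \<tau> p u \<longleftrightarrow> f ((1 / 2) \<cdot> (u + p)) = (1 / 2) \<cdot> (u + p)"
    if u: "u \<in> S" for u
  proof -
    define \<xi> where "\<xi> = (1 / 2) \<cdot> (u + p)"
    have \<xi>: "\<xi> \<in> S" using S u by (simp add: \<xi>_def)
    have "2 \<cdot> \<xi> = u + p" "2 \<cdot> p = p + p"
      using scale_left_distrib[of 1 1 p] by (simp_all add: \<xi>_def)
    then have up: "u - p = 2 \<cdot> (\<xi> - p)"
      by (simp add: scale_right_diff_distrib)
    define k where "k = \<i> * of_real (inverse \<tau>) * 2"
    have k: "k \<noteq> 0" "inverse k = - (\<i> * of_real (\<tau> / 2))"
      using \<tau> by (auto simp: k_def field_simps)
    have "ip \<phi> (k \<cdot> (\<xi> - p) - G \<xi>) = k * ip \<phi> (\<xi> - p) - F \<phi> \<xi>"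
      "\<i> * ip \<phi> (of_real (inverse \<tau>) \<cdot> 2 \<cdot> (\<xi> - p)) = k * ip \<phi> (\<xi> - p)" if "\<phi> \<in> S" for \<phi>
      using that \<xi> S G by (simp_all add: ip_diff ip_scale k_def mult.assoc)
    then have "midpoint_step F \<tau> p u \<longleftrightarrow> (\<forall>\<phi>\<in>S. ip \<phi> (k \<cdot> (\<xi> - p) - G \<xi>) = 0)"
      unfolding midpoint_step_def \<xi>_def[symmetric] up
      by simp
    also have "\<dots> \<longleftrightarrow> k \<cdot> (\<xi> - p) - G \<xi> = 0"
    proof
      assume *: "\<forall>\<phi>\<in>S. ip \<phi> (k \<cdot> (\<xi> - p) - G \<xi>) = 0"
      have "k \<cdot> (\<xi> - p) - G \<xi> \<in> S" using \<xi> S G by simp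
      with * show "k \<cdot> (\<xi> - p) - G \<xi> = 0" using ip_pos by fastforce
    qed simp
    also have "\<dots> \<longleftrightarrow> \<xi> - p = inverse k \<cdot> G \<xi>"
      using k(1) by (metis eq_iff_diff_eq_0 field_class.field_inverse right_inverse scale_one scale_scale)
    also have "\<dots> \<longleftrightarrow> f \<xi> = \<xi>"
      unfolding k(2) f_def by (auto simp: algebra_simps)
    finally show ?thesis by (simp add: \<xi>_def)
  qed
  obtain \<xi> where \<xi>: "\<xi> \<in> S" "nrm \<xi> \<le> R" "f \<xi> = \<xi>"
    using ball_contraction_fixpoint[of R "1/2" f] R1 fS fR fcon by auto
  define u where "u = 2 \<cdot> \<xi> - p"
  have u: "u \<in> S" "(1 / 2) \<cdot> (u + p) = \<xi>" using \<xi> S by (auto simp: u_def)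
  then have "midpoint_step F \<tau> p u" using step_iff \<xi> by simp
  moreover have "w = u" if w: "w \<in> S" "midpoint_step F \<tau> p w" for w
  proof -
    define \<eta> where "\<eta> = (1 / 2) \<cdot> (w + p)"
    have \<eta>: "\<eta> \<in> S" "f \<eta> = \<eta>" using w S step_iff by (auto simp: \<eta>_def)
    \<comment> \<open>the a priori bound which confines an arbitrary solution to the ball\<close>
    have "nrm w = nrm p" using midpoint_step_nrm[OF S w(1) \<tau>(1) real w(2)] .
    then have "nrm \<eta> \<le> nrm p"
      using nrm_triangle[of w p] w S nrm_scale[of "w + p" "1/2"] by (simp add: \<eta>_def)
    then have "nrm (\<eta> - \<xi>) \<le> 1/2 * nrm (\<eta> - \<xi>)"
      using fcon[of \<eta> \<xi>] \<xi> \<eta> R by simp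
    then have "nrm (\<eta> - \<xi>) = 0" using nrm_nonneg[OF S_diff[OF \<eta>(1) \<xi>(1)]] by linarith
    then have "\<eta> = \<xi>" using nrm_eq_zero[of "\<eta> - \<xi>"] \<xi> \<eta> by simp
    then have "2 \<cdot> (1 / 2) \<cdot> (w + p) = 2 \<cdot> (1 / 2) \<cdot> (u + p)" using u by (simp add: \<eta>_def)
    then show ?thesis by simp
  qed
  ultimately show ?thesis using u by blast
qed

end

text \<open>
  Uniquely solvable steps that preserve \<open>P\<close> can be iterated. The invariant matters because a step is
  known to be solvable only from states satisfying \<open>P\<close>, here those of the initial mass.
\<close>
lemma ex1_iterated_tuple:
  assumes P0: "P x0" and PA: "\<And>x. P x \<Longrightarrow> x \<in> A"
    and ex1: "\<And>x. P x \<Longrightarrow> \<exists>!y. y \<in> A \<and> R x y"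
    and inv: "\<And>x y. P x \<Longrightarrow> y \<in> A \<Longrightarrow> R x y \<Longrightarrow> P y"
  shows "\<exists>!X. X \<in> {0..N::nat} \<rightarrow>\<^sub>E A \<and> X 0 = x0 \<and> (\<forall>n\<in>{1..N}. R (X (n - 1)) (X n))"
proof -
  define Y where "Y = rec_nat x0 (\<lambda>_ x. THE y. y \<in> A \<and> R x y)"
  have Y0: "Y 0 = x0" and YS: "Y (Suc n) = (THE y. y \<in> A \<and> R (Y n) y)" for n
    by (simp_all add: Y_def)
  have step: "Y (Suc n) \<in> A \<and> R (Y n) (Y (Suc n))" if "P (Y n)" for n
    unfolding YS using theI'[OF ex1[OF that]] .
  have PY: "P (Y n)" for n
    by (induction n) (use P0 Y0 step inv in auto)
  show ?thesis
  proof (rule ex1I[of _ "restrict Y {0..N}"])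
    show "restrict Y {0..N} \<in> {0..N} \<rightarrow>\<^sub>E A \<and> restrict Y {0..N} 0 = x0 \<and>
      (\<forall>n\<in>{1..N}. R (restrict Y {0..N} (n - 1)) (restrict Y {0..N} n))"
    proof (intro conjI ballI)
      fix n assume n: "n \<in> {1..N}"
      then obtain m where "n = Suc m" by (cases n) auto
      then show "R (restrict Y {0..N} (n - 1)) (restrict Y {0..N} n)"
        using n step[OF PY, of m] by simp
    qed (use PY PA Y0 in auto)
  next
    fix X assume X: "X \<in> {0..N} \<rightarrow>\<^sub>E A \<and> X 0 = x0 \<and> (\<forall>n\<in>{1..N}. R (X (n - 1)) (X n))"
    have "X n = Y n" if "n \<le> N" for n
      using that
    proof (induction n)
      case 0 then show ?case using X Y0 by simp
    next
      case (Suc n)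
      then have "X (Suc n) \<in> A \<and> R (Y n) (X (Suc n))" using X
        by (metis (no_types, lifting) PiE_mem Suc_leD atLeastAtMost_iff diff_Suc_1 le_add1 plus_1_eq_Suc zero_le)
      then show ?case using step[OF PY, of n] ex1[OF PY, of n] by blast
    qed
    then show "X = restrict Y {0..N}"
      using X by (auto simp: fun_eq_iff PiE_def extensional_def)
  qed
qed


section \<open>Square integrable functions\<close>

text \<open>
  Galerkin functions, test functions and Hartree terms all lie in this class. On a bounded open set
  its members are integrable, and it is closed under products, so that one argument settles the
  integrability of every integrand that contains no weak gradient.
\<close>
definition bounded_measurable :: "(real^'d) set \<Rightarrow> (real^'d \<Rightarrow> 'b::euclidean_space) \<Rightarrow> bool" where
  "bounded_measurable \<Omega> u \<longleftrightarrow>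
     u \<in> borel_measurable (lebesgue_on \<Omega>) \<and> (\<exists>B. \<forall>x\<in>\<Omega>. norm (u x) \<le> B)"

lemma bounded_measurable_mult:
  fixes u w :: "real^'d \<Rightarrow> complex"
  assumes "bounded_measurable \<Omega> u" "bounded_measurable \<Omega> w"
  shows "bounded_measurable \<Omega> (\<lambda>x. u x * w x)"
proof -
  obtain A B where "\<forall>x\<in>\<Omega>. norm (u x) \<le> A" "\<forall>x\<in>\<Omega>. norm (w x) \<le> B"
    using assms by (auto simp: bounded_measurable_def)
  then have "\<forall>x\<in>\<Omega>. norm (u x * w x) \<le> A * B"
    by (auto simp: norm_mult intro!: mult_mono intro: order_trans[OF norm_ge_zero])
  moreover have "(\<lambda>x. u x * w x) \<in> borel_measurable (lebesgue_on \<Omega>)"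
    using assms by (intro borel_measurable_times) (auto simp: bounded_measurable_def)
  ultimately show ?thesis by (auto simp: bounded_measurable_def)
qed

lemma bounded_measurable_diff:
  assumes "bounded_measurable \<Omega> u" "bounded_measurable \<Omega> w"
  shows "bounded_measurable \<Omega> (\<lambda>x. u x - w x)"
proof -
  obtain A B where "\<forall>x\<in>\<Omega>. norm (u x) \<le> A" "\<forall>x\<in>\<Omega>. norm (w x) \<le> B"
    using assms by (auto simp: bounded_measurable_def)
  then have "\<forall>x\<in>\<Omega>. norm (u x - w x) \<le> A + B"
    by (auto intro: norm_triangle_le_diff add_mono)
  moreover have "(\<lambda>x. u x - w x) \<in> borel_measurable (lebesgue_on \<Omega>)"
    using assms by (intro borel_measurable_diff) (auto simp: bounded_measurable_def)
  ultimately show ?thesis by (auto simp: bounded_measurable_def)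
qed

lemma bounded_measurable_cnj:
  assumes "bounded_measurable \<Omega> u"
  shows "bounded_measurable \<Omega> (\<lambda>x. cnj (u x))"
proof -
  have "(\<lambda>x. cnj (u x)) \<in> borel_measurable (lebesgue_on \<Omega>)"
    using assms borel_measurable_continuous_onI[OF linear_continuous_on[OF bounded_linear_cnj]]
    by (auto simp: bounded_measurable_def intro: measurable_compose)
  then show ?thesis using assms by (simp add: bounded_measurable_def)
qed

lemma bounded_measurable_continuous:
  assumes "continuous_on \<Omega> u" "open \<Omega>" "\<And>x. x \<in> \<Omega> \<Longrightarrow> norm (u x) \<le> B"
  shows "bounded_measurable \<Omega> u"
  using assms unfolding bounded_measurable_def
  by (auto intro!: continuous_imp_measurable_on_sets_lebesgue)

lemma open_bounded_finite_measure:
  fixes \<Omega> :: "(real^'d) set"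
  assumes "open \<Omega>" "bounded \<Omega>"
  shows "finite_measure (lebesgue_on \<Omega>)"
  using assms by (intro finite_measure_lebesgue_on lmeasurable_open)

lemma bounded_measurable_integrable:
  fixes \<Omega> :: "(real^'d) set"
  assumes "open \<Omega>" "bounded \<Omega>" "bounded_measurable \<Omega> u"
  shows "integrable (lebesgue_on \<Omega>) u"
proof -
  obtain B where "\<forall>x\<in>\<Omega>. norm (u x) \<le> B" using assms by (auto simp: bounded_measurable_def)
  then show ?thesis
    using assms open_bounded_finite_measure
    by (intro finite_measure.integrable_const_bound[of _ _ B])
      (auto simp: bounded_measurable_def intro!: AE_I2)
qed

lemma integral_bound:
  fixes \<Omega> :: "(real^'d) set" and u :: "real^'d \<Rightarrow> complex"
  assumes "open \<Omega>" "bounded \<Omega>" "bounded_measurable \<Omega> u" "\<And>x. x \<in> \<Omega> \<Longrightarrow> cmod (u x) \<le> B"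
  shows "cmod (\<integral>x. u x \<partial>lebesgue_on \<Omega>) \<le> B * measure lebesgue \<Omega>"
proof -
  interpret finite_measure "lebesgue_on \<Omega>" using assms open_bounded_finite_measure by blast
  have int: "integrable (lebesgue_on \<Omega>) u" using assms bounded_measurable_integrable by blast
  have "cmod (\<integral>x. u x \<partial>lebesgue_on \<Omega>) \<le> (\<integral>x. cmod (u x) \<partial>lebesgue_on \<Omega>)"
    by (rule integral_norm_bound)
  also have "\<dots> \<le> (\<integral>x. B \<partial>lebesgue_on \<Omega>)"
    using int assms by (intro integral_mono) auto
  also have "\<dots> = B * measure lebesgue \<Omega>"
    using assms by (simp add: measure_restrict_space)
  finally show ?thesis .
qed

lemma L2_space_bounded_measurable:
  fixes \<Omega> :: "(real^'d) set"
  assumes "open \<Omega>" "bounded \<Omega>" "bounded_measurable \<Omega> u"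
  shows "u \<in> L2_space \<Omega>"
proof -
  obtain B where B: "\<forall>x\<in>\<Omega>. norm (u x) \<le> B" using assms by (auto simp: bounded_measurable_def)
  have "bounded_measurable \<Omega> (\<lambda>x. (norm (u x))\<^sup>2)"
    unfolding bounded_measurable_def using assms B
    by (auto simp: bounded_measurable_def intro!: exI[of _ "B\<^sup>2"] power_mono)
  then have "integrable (lebesgue_on \<Omega>) (\<lambda>x. (norm (u x))\<^sup>2)"
    by (rule bounded_measurable_integrable[OF assms(1,2)])
  then show ?thesis using assms(3) by (simp add: L2_space_def bounded_measurable_def)
qed

lemma L2_space_diff:
  fixes f g :: "real^'d \<Rightarrow> 'b::euclidean_space"
  assumes "f \<in> L2_space \<Omega>" "g \<in> L2_space \<Omega>"
  shows "(\<lambda>x. f x - g x) \<in> L2_space \<Omega>"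
proof -
  have "(norm (a - b))\<^sup>2 \<le> 2 * (norm a)\<^sup>2 + 2 * (norm b)\<^sup>2" for a b :: 'b
  proof -
    have "(norm (a - b))\<^sup>2 \<le> (norm a + norm b)\<^sup>2" by (intro power_mono norm_triangle_ineq4) simp
    also have "\<dots> \<le> 2 * (norm a)\<^sup>2 + 2 * (norm b)\<^sup>2"
      using sum_squares_bound[of "norm a" "norm b"] by (simp add: power2_sum)
    finally show ?thesis .
  qed
  then have bound: "AE x in lebesgue_on \<Omega>. norm ((norm (f x - g x))\<^sup>2) \<le>
      norm (2 * (norm (f x))\<^sup>2 + 2 * (norm (g x))\<^sup>2)"
    by (intro AE_I2) (simp add: abs_of_nonneg)
  have "integrable (lebesgue_on \<Omega>) (\<lambda>x. (norm (f x - g x))\<^sup>2)"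
    by (rule Bochner_Integration.integrable_bound[OF _ _ bound])
      (use assms in \<open>auto simp: L2_space_def\<close>)
  then show ?thesis using assms by (auto simp: L2_space_def)
qed

lemma L2_space_nth:
  assumes "G \<in> L2_space \<Omega>"
  shows "(\<lambda>x. G x $ i) \<in> L2_space \<Omega>"
proof -
  have meas: "(\<lambda>x. G x $ i) \<in> borel_measurable (lebesgue_on \<Omega>)"
    using assms measurable_compose[OF _
      borel_measurable_continuous_onI[OF linear_continuous_on[OF bounded_linear_vec_nth]]]
    by (auto simp: L2_space_def)
  moreover have "integrable (lebesgue_on \<Omega>) (\<lambda>x. (norm (G x $ i))\<^sup>2)"
  proof (rule Bochner_Integration.integrable_bound)
    show "integrable (lebesgue_on \<Omega>) (\<lambda>x. (norm (G x))\<^sup>2)" using assms by (simp add: L2_space_def)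
    show "AE x in lebesgue_on \<Omega>. norm ((norm (G x $ i))\<^sup>2) \<le> norm ((norm (G x))\<^sup>2)"
      by (intro AE_I2) (simp add: power_mono Finite_Cartesian_Product.norm_nth_le)
  qed (use meas in auto)
  ultimately show ?thesis by (simp add: L2_space_def)
qed

lemma L2_space_cnj: "f \<in> L2_space \<Omega> \<Longrightarrow> (\<lambda>x. cnj (f x)) \<in> L2_space \<Omega>"
  using borel_measurable_continuous_onI[OF linear_continuous_on[OF bounded_linear_cnj]]
  by (auto simp: L2_space_def intro: measurable_compose)

lemma L2_space_cmult: "f \<in> L2_space \<Omega> \<Longrightarrow> (\<lambda>x. c * f x) \<in> L2_space \<Omega>" for c :: complex
  by (auto simp: L2_space_def norm_mult power_mult_distrib)

lemma L2_mult_integrable: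
  fixes f g :: "real^'d \<Rightarrow> complex"
  assumes "f \<in> L2_space \<Omega>" "g \<in> L2_space \<Omega>"
  shows "integrable (lebesgue_on \<Omega>) (\<lambda>x. f x * g x)"
proof (rule Bochner_Integration.integrable_bound[of _ "\<lambda>x. (norm (f x))\<^sup>2 + (norm (g x))\<^sup>2"])
  have "a * b \<le> a\<^sup>2 + b\<^sup>2" if "a \<ge> 0" "b \<ge> 0" for a b :: real
    using sum_squares_bound[of a b] mult_nonneg_nonneg[OF that] by linarith
  then show "AE x in lebesgue_on \<Omega>. norm (f x * g x) \<le> norm ((norm (f x))\<^sup>2 + (norm (g x))\<^sup>2)"
    by (intro AE_I2) (simp add: norm_mult)
qed (use assms in \<open>auto simp: L2_space_def\<close>)

lemma L2_norm_sq: "(L2_norm \<Omega> f)\<^sup>2 = (\<integral>x. (norm (f x))\<^sup>2 \<partial>lebesgue_on \<Omega>)"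
  by (simp add: L2_norm_def)

lemma L2_norm_nonneg [simp]: "0 \<le> L2_norm \<Omega> f"
  by (simp add: L2_norm_def)

text \<open>
  Integrate the inequality \<open>2 * t * a * b \<le> t\<^sup>2 * a\<^sup>2 + b\<^sup>2\<close> pointwise and optimize in \<open>t\<close>. The squared
  form is degenerate on representatives, so the case of a null function \<open>f\<close> is separate.
\<close>
lemma L2_cauchy_schwarz:
  fixes f g :: "real^'d \<Rightarrow> complex"
  assumes f: "f \<in> L2_space \<Omega>" and g: "g \<in> L2_space \<Omega>"
  shows "cmod (\<integral>x. f x * g x \<partial>lebesgue_on \<Omega>) \<le> L2_norm \<Omega> f * L2_norm \<Omega> g"
proof -
  define A where "A = L2_norm \<Omega> f"
  define B where "B = L2_norm \<Omega> g"
  define C where "C = (\<integral>x. cmod (f x * g x) \<partial>lebesgue_on \<Omega>)"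
  have AB: "A \<ge> 0" "B \<ge> 0" by (auto simp: A_def B_def)
  have young: "2 * t * C \<le> t\<^sup>2 * A\<^sup>2 + B\<^sup>2" for t
  proof -
    have "2 * t * C = (\<integral>x. 2 * t * cmod (f x * g x) \<partial>lebesgue_on \<Omega>)"
      by (simp add: C_def)
    also have "\<dots> \<le> (\<integral>x. t\<^sup>2 * (cmod (f x))\<^sup>2 + (cmod (g x))\<^sup>2 \<partial>lebesgue_on \<Omega>)"
    proof (intro integral_mono)
      show "2 * t * cmod (f x * g x) \<le> t\<^sup>2 * (cmod (f x))\<^sup>2 + (cmod (g x))\<^sup>2" for x
        using sum_squares_bound[of "t * cmod (f x)" "cmod (g x)"]
        by (simp add: norm_mult power_mult_distrib mult.assoc)
    qed (use f g L2_mult_integrable[OF f g] in \<open>auto simp: L2_space_def\<close>)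
    also have "\<dots> = t\<^sup>2 * A\<^sup>2 + B\<^sup>2"
      unfolding A_def B_def L2_norm_sq using f g by (simp add: L2_space_def)
    finally show ?thesis .
  qed
  have "C \<le> A * B"
  proof (cases "A = 0")
    case True
    have "C \<le> 0"
    proof (rule ccontr)
      assume "\<not> C \<le> 0"
      then show False using young[of "(B\<^sup>2 + 1) / C"] True zero_le_power2[of B] by (simp; linarith)
    qed
    then show ?thesis using True by simp
  next
    case False
    then have pos: "A > 0" using AB by simp
    \<comment> \<open>\<open>t = C / A\<^sup>2\<close> is the optimal choice\<close>
    have "2 * (C / A\<^sup>2) * C = 2 * (C\<^sup>2 / A\<^sup>2)" "(C / A\<^sup>2)\<^sup>2 * A\<^sup>2 = C\<^sup>2 / A\<^sup>2"
      using pos by (simp_all add: field_simps power2_eq_square)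
    then have "C\<^sup>2 / A\<^sup>2 \<le> B\<^sup>2" using young[of "C / A\<^sup>2"] by linarith
    then have "C\<^sup>2 \<le> (A * B)\<^sup>2" using pos by (simp add: field_simps)
    then show ?thesis using AB by - (rule power2_le_imp_le, simp_all)
  qed
  then show ?thesis
    unfolding A_def B_def C_def by (rule order_trans[OF integral_norm_bound])
qed

lemma L2_inner_cnj: "L2_inner \<Omega> u w = cnj (L2_inner \<Omega> w u)"
  unfolding L2_inner_def
  using Bochner_Integration.integral_cnj[of "lebesgue_on \<Omega>" "\<lambda>x. cnj (w x) * u x"] by (simp add: mult.commute)

lemma L2_inner_linear:
  assumes "\<phi> \<in> L2_space \<Omega>" "u \<in> L2_space \<Omega>" "w \<in> L2_space \<Omega>"
  shows "L2_inner \<Omega> \<phi> (\<lambda>x. u x + c * w x) = L2_inner \<Omega> \<phi> u + c * L2_inner \<Omega> \<phi> w"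
proof -
  have "L2_inner \<Omega> \<phi> (\<lambda>x. u x + c * w x) =
      (\<integral>x. cnj (\<phi> x) * u x + c * (cnj (\<phi> x) * w x) \<partial>lebesgue_on \<Omega>)"
    unfolding L2_inner_def by (simp add: algebra_simps)
  also have "\<dots> = L2_inner \<Omega> \<phi> u + c * L2_inner \<Omega> \<phi> w"
    unfolding L2_inner_def
    using L2_mult_integrable[OF L2_space_cnj[OF assms(1)] assms(2)]
      L2_mult_integrable[OF L2_space_cnj[OF assms(1)] assms(3)] by simp
  finally show ?thesis .
qed

lemma L2_inner_self: "L2_inner \<Omega> u u = of_real ((L2_norm \<Omega> u)\<^sup>2)"
proof -
  have "cnj (u x) * u x = of_real ((cmod (u x))\<^sup>2)" for x
    by (metis complex_norm_square mult.commute)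
  then have "L2_inner \<Omega> u u = (\<integral>x. of_real ((cmod (u x))\<^sup>2) \<partial>lebesgue_on \<Omega>)"
    unfolding L2_inner_def by presburger
  then show ?thesis unfolding L2_norm_sq by (simp only: integral_complex_of_real)
qed

lemma L2_norm_eq_0_AE:
  assumes "f \<in> L2_space \<Omega>" "L2_norm \<Omega> f = 0"
  shows "AE x in lebesgue_on \<Omega>. f x = 0"
  using assms integral_nonneg_eq_0_iff_AE[of "lebesgue_on \<Omega>" "\<lambda>x. (norm (f x))\<^sup>2"]
  by (simp add: L2_norm_def L2_space_def)

section \<open>Test functions and weak gradients\<close>

lemma test_functions_continuous: "f \<in> test_functions U \<Longrightarrow> continuous_on A f"
proof -
  assume "f \<in> test_functions U"
  then have "higher_differentiable_on UNIV f 0"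
    unfolding test_functions_def smooth_on_def by blast
  then show ?thesis by (auto intro: continuous_on_subset)
qed

lemma test_functions_bounded:
  assumes f: "f \<in> test_functions U"
  obtains B where "B \<ge> 0" "\<And>x. norm (f x) \<le> B"
proof -
  define K where "K = closure {x. f x \<noteq> 0}"
  have "bounded (f ` K)"
    using f test_functions_continuous[OF f]
    by (intro compact_imp_bounded compact_continuous_image) (auto simp: test_functions_def K_def)
  then obtain B where B: "B > 0" "\<forall>y\<in>f ` K. norm y \<le> B" by (auto simp: bounded_pos)
  have "norm (f x) \<le> B" for x
    using B closure_subset[of "{x. f x \<noteq> 0}"] by (cases "f x = 0") (auto simp: K_def)
  then show thesis using B that[of B] by simp
qed

text \<open>
  Together with the next lemma this makes the conjugate of a partial derivative of a test function
  a test function again, so weak gradients may be tested with it.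
\<close>
lemma test_functions_cnj:
  fixes f :: "'a::real_normed_vector \<Rightarrow> complex"
  assumes "f \<in> test_functions U"
  shows "(\<lambda>x. cnj (f x)) \<in> test_functions U"
proof -
  have "higher_differentiable_on UNIV (\<lambda>x. cnj (g x)) k"
    if "higher_differentiable_on UNIV g k" for k and g :: "'a \<Rightarrow> complex"
    using that
  proof (induction k arbitrary: g)
    case 0
    then show ?case by (simp add: continuous_on_cnj)
  next
    case (Suc k)
    have D: "((\<lambda>x. cnj (g x)) has_derivative (\<lambda>w. cnj (frechet_derivative g (at x) w))) (at x)" for x
    proof -
      have "g differentiable (at x)" using Suc.prems by simp
      then have "(g has_derivative frechet_derivative g (at x)) (at x)"
        using frechet_derivative_works by blast
      then show ?thesis by (rule bounded_linear.has_derivative[OF bounded_linear_cnj])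
    qed
    then have "frechet_derivative (\<lambda>x. cnj (g x)) (at x) = (\<lambda>w. cnj (frechet_derivative g (at x) w))" for x
      using frechet_derivative_at by metis
    then show ?case using D Suc by (auto simp: differentiable_def)
  qed
  then show ?thesis using assms unfolding test_functions_def smooth_on_def by simp blast
qed

text \<open>
  Where \<open>f\<close> vanishes on an open set so does its derivative; hence the support does not grow.
\<close>
lemma test_functions_derivative:
  assumes f: "f \<in> test_functions U"
  shows "(\<lambda>x. frechet_derivative f (at x) w) \<in> test_functions U"
proof -
  define K where "K = closure {x. f x \<noteq> 0}"
  define g where "g x = frechet_derivative f (at x) w" for x
  have "smooth_on UNIV g"
    unfolding smooth_on_def
  proof
    fix k
    have "higher_differentiable_on UNIV f (Suc k)"
      using f by (simp add: test_functions_def smooth_on_def del: higher_differentiable_on.simps)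
    then show "higher_differentiable_on UNIV g k" by (simp add: g_def[abs_def])
  qed
  moreover have "{x. g x \<noteq> 0} \<subseteq> K"
  proof (rule ccontr)
    assume "\<not> {x. g x \<noteq> 0} \<subseteq> K"
    then obtain x where x: "g x \<noteq> 0" "x \<in> - K" by auto
    have "f y = 0" if "y \<in> - K" for y
      using that closure_subset[of "{x. f x \<noteq> 0}"] by (auto simp: K_def)
    moreover have "open (- K)" by (simp add: K_def open_Compl)
    ultimately have "(f has_derivative (\<lambda>_. 0)) (at x)"
      using has_derivative_transform_within_open[of "\<lambda>_. 0" "\<lambda>_. 0" x UNIV "- K" f] x by auto
    then have "frechet_derivative f (at x) = (\<lambda>_. 0)" using frechet_derivative_at by metis
    then show False using x by (simp add: g_def)
  qed
  then have supp: "closure {x. g x \<noteq> 0} \<subseteq> K"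
    using closure_mono[of "{x. g x \<noteq> 0}" K] by (simp add: K_def)
  moreover have K: "compact K" "K \<subseteq> U" using f by (auto simp: test_functions_def K_def)
  moreover have "compact (closure {x. g x \<noteq> 0})"
    using compact_Int_closed[OF K(1) closed_closure, of "{x. g x \<noteq> 0}"] supp
    by (simp add: Int_absorb1)
  ultimately have "g \<in> test_functions U"
    unfolding test_functions_def by blast
  then show ?thesis by (simp add: g_def[abs_def])
qed

lemma test_functions_bounded_measurable:
  fixes f :: "real^'d \<Rightarrow> 'b::euclidean_space"
  assumes "f \<in> test_functions U" "open \<Omega>"
  shows "bounded_measurable \<Omega> f"
proof -
  obtain B where "\<And>x. norm (f x) \<le> B" using test_functions_bounded[OF assms(1)] by metis
  then show ?thesis
    using assms test_functions_continuous by (intro bounded_measurable_continuous[of _ _ B]) auto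
qed

lemma gradient_nth_test_function:
  "\<phi> \<in> test_functions U \<Longrightarrow> (\<lambda>x. gradient \<phi> x $ i) \<in> test_functions U"
  unfolding gradient_def by (simp add: test_functions_derivative)

lemma gradient_bounded_measurable:
  assumes \<phi>: "\<phi> \<in> test_functions U" and \<Omega>: "open \<Omega>"
  shows "bounded_measurable \<Omega> (gradient \<phi>)"
proof -
  have "\<exists>B. \<forall>x. cmod (gradient \<phi> x $ i) \<le> B" for i
    using test_functions_bounded[OF gradient_nth_test_function[OF \<phi>]] by metis
  then obtain B where B: "\<And>i x. cmod (gradient \<phi> x $ i) \<le> B i" by metis
  have "continuous_on \<Omega> (\<lambda>x. \<chi> i. gradient \<phi> x $ i)"
    using test_functions_continuous[OF gradient_nth_test_function[OF \<phi>]]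
    by (intro continuous_on_vec_lambda) auto
  moreover have "norm (gradient \<phi> x) \<le> (\<Sum>i\<in>UNIV. B i)" for x
  proof -
    have "norm (gradient \<phi> x) \<le> (\<Sum>i\<in>UNIV. norm (gradient \<phi> x $ i))"
      unfolding norm_vec_def by (intro L2_set_le_sum) simp
    also have "\<dots> \<le> (\<Sum>i\<in>UNIV. B i)" using B by (intro sum_mono)
    finally show ?thesis .
  qed
  ultimately show ?thesis using \<Omega> by (intro bounded_measurable_continuous) auto
qed

lemma weak_gradient_works: "u \<in> H1_space \<Omega> \<Longrightarrow> has_L2_weak_gradient \<Omega> u (weak_gradient \<Omega> u)"
  unfolding weak_gradient_def H1_space_def by (metis (mono_tags, lifting) mem_Collect_eq someI_ex)

lemma weak_gradient_nth_L2: "u \<in> H1_space \<Omega> \<Longrightarrow> (\<lambda>x. weak_gradient \<Omega> u x $ i) \<in> L2_space \<Omega>"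
  using weak_gradient_works by (intro L2_space_nth) (auto simp: has_L2_weak_gradient_def)

text \<open>
  The gradient of \<open>u\<close> is an \<open>L\<^sup>2\<close> limit of gradients of test functions, whose components are
  themselves test functions. Orthogonality to test functions thus passes to the limit.
\<close>
lemma H10_gradient_orthogonal:
  fixes \<Omega> :: "(real^'d) set"
  assumes \<Omega>: "open \<Omega>" "bounded \<Omega>" and D: "D \<in> L2_space \<Omega>" and u: "u \<in> H10_space \<Omega>"
    and orth: "\<And>\<phi>. \<phi> \<in> test_functions \<Omega> \<Longrightarrow> (\<integral>x. D x * \<phi> x \<partial>lebesgue_on \<Omega>) = 0"
  shows "(\<integral>x. D x * cnj (weak_gradient \<Omega> u x $ i) \<partial>lebesgue_on \<Omega>) = 0"
proof -
  have u1: "u \<in> H1_space \<Omega>" using u by (simp add: H10_space_def)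
  obtain \<phi> where \<phi>: "\<And>n::nat. \<phi> n \<in> test_functions \<Omega>"
    and lim: "(\<lambda>n. L2_norm \<Omega> (\<lambda>x. weak_gradient \<Omega> u x - gradient (\<phi> n) x)) \<longlonglongrightarrow> 0"
    using u by (auto simp: H10_space_def)
  define I where "I = (\<integral>x. D x * cnj (weak_gradient \<Omega> u x $ i) \<partial>lebesgue_on \<Omega>)"
  have bound: "cmod I \<le> L2_norm \<Omega> D * L2_norm \<Omega> (\<lambda>x. weak_gradient \<Omega> u x - gradient (\<phi> n) x)" for n
  proof -
    define d where "d x = weak_gradient \<Omega> u x - gradient (\<phi> n) x" for x
    have test: "(\<lambda>x. cnj (gradient (\<phi> n) x $ i)) \<in> test_functions \<Omega>"
      by (intro test_functions_cnj gradient_nth_test_function \<phi>)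
    then have testL2: "(\<lambda>x. cnj (gradient (\<phi> n) x $ i)) \<in> L2_space \<Omega>"
      using \<Omega> by (intro L2_space_bounded_measurable test_functions_bounded_measurable)
    have dL2: "d \<in> L2_space \<Omega>"
      unfolding d_def[abs_def]
      using weak_gradient_works[OF u1] gradient_bounded_measurable[OF \<phi> \<Omega>(1)] \<Omega>
      by (intro L2_space_diff L2_space_bounded_measurable[of \<Omega> "gradient (\<phi> n)"]) (auto simp: has_L2_weak_gradient_def)
    have "I = I - (\<integral>x. D x * cnj (gradient (\<phi> n) x $ i) \<partial>lebesgue_on \<Omega>)"
      using orth[OF test] by simp
    also have "\<dots> = (\<integral>x. D x * cnj (d x $ i) \<partial>lebesgue_on \<Omega>)"
      unfolding I_def d_def
        Bochner_Integration.integral_diff[OF L2_mult_integrable[OF D L2_space_cnj[OF weak_gradient_nth_L2[OF u1]]]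
          L2_mult_integrable[OF D testL2], symmetric]
      by (simp add: right_diff_distrib)
    also have "cmod \<dots> \<le> L2_norm \<Omega> D * L2_norm \<Omega> (\<lambda>x. cnj (d x $ i))"
      by (intro L2_cauchy_schwarz D L2_space_cnj L2_space_nth dL2)
    also have "L2_norm \<Omega> (\<lambda>x. cnj (d x $ i)) \<le> L2_norm \<Omega> d"
      unfolding L2_norm_def real_sqrt_le_iff using dL2 L2_space_nth[OF dL2, of i]
      by (intro integral_mono) (auto simp: L2_space_def intro!: power_mono Finite_Cartesian_Product.norm_nth_le)
    finally show ?thesis by (simp add: d_def[abs_def] mult_left_mono)
  qed
  have "(\<lambda>n. L2_norm \<Omega> D * L2_norm \<Omega> (\<lambda>x. weak_gradient \<Omega> u x - gradient (\<phi> n) x)) \<longlonglongrightarrow> L2_norm \<Omega> D * 0"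
    by (intro tendsto_mult lim tendsto_const)
  then have "cmod I \<le> 0"
    using bound by (intro LIMSEQ_le_const) auto
  then show ?thesis by (simp add: I_def)
qed

text \<open>
  Weak gradients are chosen representatives, so linearity can hold only almost everywhere, and it
  amounts to uniqueness of weak gradients. On \<open>H\<^sup>1\<^sub>0\<close> uniqueness follows without mollifiers: the
  defect \<open>D\<close> is orthogonal to all test functions by integration by parts, hence to the gradients
  of \<open>H\<^sup>1\<^sub>0\<close> functions, of which it is a linear combination; so it is orthogonal to itself.
\<close>
lemma H10_weak_gradient_linear:
  fixes \<Omega> :: "(real^'d) set"
  assumes \<Omega>: "open \<Omega>" "bounded \<Omega>"
    and u: "u \<in> H10_space \<Omega>" and w: "w \<in> H10_space \<Omega>" and z: "z \<in> H10_space \<Omega>"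
    and lin: "\<And>x. z x = u x + c * w x"
  shows "AE x in lebesgue_on \<Omega>. weak_gradient \<Omega> z x $ i = weak_gradient \<Omega> u x $ i + c * weak_gradient \<Omega> w x $ i"
proof -
  define g where "g y x = weak_gradient \<Omega> y x $ i" for y x
  have H1: "u \<in> H1_space \<Omega>" "w \<in> H1_space \<Omega>" "z \<in> H1_space \<Omega>"
    using u w z by (auto simp: H10_space_def)
  have gL2: "g y \<in> L2_space \<Omega>" if "y \<in> H1_space \<Omega>" for y
    using weak_gradient_nth_L2[OF that] by (simp add: g_def[abs_def])
  define D where "D x = g z x - g u x - c * g w x" for x
  have D: "D \<in> L2_space \<Omega>"
    unfolding D_def[abs_def] by (intro L2_space_diff L2_space_cmult gL2 H1)
  have orth: "(\<integral>x. D x * \<phi> x \<partial>lebesgue_on \<Omega>) = 0" if \<phi>: "\<phi> \<in> test_functions \<Omega>" for \<phi>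
  proof -
    define \<phi>' where "\<phi>' x = gradient \<phi> x $ i" for x
    have L2: "\<phi> \<in> L2_space \<Omega>" "\<phi>' \<in> L2_space \<Omega>"
      using \<phi> gradient_nth_test_function[OF \<phi>] \<Omega> unfolding \<phi>'_def[abs_def]
      by (blast intro: L2_space_bounded_measurable test_functions_bounded_measurable)+
    have wg: "(\<integral>x. g y x * \<phi> x \<partial>lebesgue_on \<Omega>) = - (\<integral>x. y x * \<phi>' x \<partial>lebesgue_on \<Omega>)"
      if "y \<in> H1_space \<Omega>" for y
      using weak_gradient_works[OF that] \<phi> by (simp add: has_L2_weak_gradient_def g_def \<phi>'_def)
    have int: "integrable (lebesgue_on \<Omega>) (\<lambda>x. y x * \<phi>' x)"
      "integrable (lebesgue_on \<Omega>) (\<lambda>x. g y x * \<phi> x)" if "y \<in> H1_space \<Omega>" for y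
      using that L2 gL2 L2_mult_integrable by (auto simp: H1_space_def)
    have "(\<integral>x. D x * \<phi> x \<partial>lebesgue_on \<Omega>) =
        (\<integral>x. g z x * \<phi> x - g u x * \<phi> x - c * (g w x * \<phi> x) \<partial>lebesgue_on \<Omega>)"
      by (simp add: D_def algebra_simps)
    also have "\<dots> = (\<integral>x. u x * \<phi>' x \<partial>lebesgue_on \<Omega>) + c * (\<integral>x. w x * \<phi>' x \<partial>lebesgue_on \<Omega>)
        - (\<integral>x. z x * \<phi>' x \<partial>lebesgue_on \<Omega>)"
      using int H1 by (simp add: wg)
    also have "(\<integral>x. z x * \<phi>' x \<partial>lebesgue_on \<Omega>) = (\<integral>x. u x * \<phi>' x + c * (w x * \<phi>' x) \<partial>lebesgue_on \<Omega>)"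
      by (simp add: lin algebra_simps)
    also have "\<dots> = (\<integral>x. u x * \<phi>' x \<partial>lebesgue_on \<Omega>) + c * (\<integral>x. w x * \<phi>' x \<partial>lebesgue_on \<Omega>)"
      using int H1 by simp
    finally show ?thesis by simp
  qed
  have perp: "(\<integral>x. D x * cnj (g y x) \<partial>lebesgue_on \<Omega>) = 0" if "y \<in> H10_space \<Omega>" for y
    unfolding g_def using H10_gradient_orthogonal[OF \<Omega> D that orth] by blast
  have int: "integrable (lebesgue_on \<Omega>) (\<lambda>x. D x * cnj (g y x))" if "y \<in> H1_space \<Omega>" for y
    by (intro L2_mult_integrable D L2_space_cnj gL2 that)
  have "L2_inner \<Omega> D D =
      (\<integral>x. D x * cnj (g z x) - D x * cnj (g u x) - cnj c * (D x * cnj (g w x)) \<partial>lebesgue_on \<Omega>)"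
    unfolding L2_inner_def by (intro Bochner_Integration.integral_cong) (auto simp: D_def algebra_simps)
  also have "\<dots> = 0"
    using int H1 perp u w z by simp
  finally have "L2_norm \<Omega> D = 0" unfolding L2_inner_self by simp
  then have "AE x in lebesgue_on \<Omega>. D x = 0" by (rule L2_norm_eq_0_AE[OF D])
  then show ?thesis by eventually_elim (simp add: D_def g_def algebra_simps)
qed

lemma gradient_inner_cnj: "gradient_inner \<Omega> u w = cnj (gradient_inner \<Omega> w u)"
  unfolding gradient_inner_def cnj_sum by (intro sum.cong refl L2_inner_cnj)

lemma gradient_inner_linear:
  fixes \<Omega> :: "(real^'d) set"
  assumes \<Omega>: "open \<Omega>" "bounded \<Omega>"
    and \<phi>: "\<phi> \<in> H10_space \<Omega>"
    and u: "u \<in> H10_space \<Omega>" and w: "w \<in> H10_space \<Omega>" and z: "u + cscale c w \<in> H10_space \<Omega>"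
  shows "gradient_inner \<Omega> \<phi> (u + cscale c w) = gradient_inner \<Omega> \<phi> u + c * gradient_inner \<Omega> \<phi> w"
proof -
  define g where "g y i x = weak_gradient \<Omega> y x $ i" for y i x
  have gL2: "g y i \<in> L2_space \<Omega>" if "y \<in> H10_space \<Omega>" for y i
    using weak_gradient_nth_L2[of y \<Omega> i] that by (simp add: g_def[abs_def] H10_space_def)
  have "L2_inner \<Omega> (g \<phi> i) (g (u + cscale c w) i) = L2_inner \<Omega> (g \<phi> i) (g u i) + c * L2_inner \<Omega> (g \<phi> i) (g w i)" for i
  proof -
    have "AE x in lebesgue_on \<Omega>. g (u + cscale c w) i x = g u i x + c * g w i x"
      unfolding g_def using H10_weak_gradient_linear[OF \<Omega> u w z] by (simp add: cscale_def)
    then have "AE x in lebesgue_on \<Omega>. cnj (g \<phi> i x) * g (u + cscale c w) i x = cnj (g \<phi> i x) * (g u i x + c * g w i x)"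
      by eventually_elim simp
    then have "L2_inner \<Omega> (g \<phi> i) (g (u + cscale c w) i) = L2_inner \<Omega> (g \<phi> i) (\<lambda>x. g u i x + c * g w i x)"
      unfolding L2_inner_def
      using L2_space_cnj[OF gL2[OF \<phi>, of i]] gL2[OF u, of i] gL2[OF w, of i] gL2[OF z, of i]
      by (intro integral_cong_AE) (auto simp: L2_space_def)
    also have "\<dots> = L2_inner \<Omega> (g \<phi> i) (g u i) + c * L2_inner \<Omega> (g \<phi> i) (g w i)"
      by (intro L2_inner_linear gL2 \<phi> u w)
    finally show ?thesis .
  qed
  then show ?thesis
    unfolding gradient_inner_def g_def by (simp add: sum.distrib sum_distrib_left)
qed

lemma gradient_inner_self_real: "Im (gradient_inner \<Omega> u u) = 0"
  unfolding gradient_inner_def L2_inner_self by simp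


section \<open>Galerkin spaces\<close>

text \<open>
  The set where \<open>u\<close> does not vanish in \<open>\<Omega>\<close> is open and null, hence empty; continuity extends this to
  the closure, and the convention of extension by zero to the whole space. This makes the \<open>L\<^sup>2\<close>
  product definite on Galerkin spaces, although it is not on \<open>L\<^sup>2\<close> representatives.
\<close>
lemma C_closure_eq_0I:
  fixes \<Omega> :: "(real^'d) set"
  assumes \<Omega>: "open \<Omega>" and u: "u \<in> C_closure \<Omega>" and ae: "AE x in lebesgue_on \<Omega>. u x = 0"
  shows "u = 0"
proof -
  have cont: "continuous_on (closure \<Omega>) u" using u by (simp add: C_closure_def)
  define U where "U = {x \<in> \<Omega>. u x \<noteq> 0}"
  have "open (\<Omega> \<inter> u -` (- {0}))"
    using \<Omega> cont closure_subset by (intro continuous_open_preimage) (auto intro: continuous_on_subset)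
  then have U: "open U" by (simp add: U_def vimage_def Int_def)
  moreover have "negligible U"
  proof -
    have "AE x in lebesgue. x \<in> \<Omega> \<longrightarrow> u x = 0"
      using ae \<Omega> by (simp add: AE_restrict_space_iff)
    then have "AE x in lebesgue. x \<notin> U" by eventually_elim (auto simp: U_def)
    then show ?thesis
      using U by (simp add: negligible_iff_null_sets AE_iff_null_sets)
  qed
  ultimately have "U = {}" using open_not_negligible by blast
  then have "\<And>x. x \<in> \<Omega> \<Longrightarrow> u x = 0" by (auto simp: U_def)
  then have "u x = 0" if "x \<in> closure \<Omega>" for x
    using continuous_constant_on_closure[OF cont] that by metis
  then show ?thesis using u by (auto simp: C_closure_def fun_eq_iff)
qed

lemma C_closure_bounded_measurable:
  fixes \<Omega> :: "(real^'d) set"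
  assumes "open \<Omega>" "bounded \<Omega>" "u \<in> C_closure \<Omega>"
  shows "bounded_measurable \<Omega> u"
proof -
  have cont: "continuous_on (closure \<Omega>) u" using assms by (simp add: C_closure_def)
  have "bounded (u ` closure \<Omega>)"
    using cont assms by (intro compact_imp_bounded compact_continuous_image) auto
  then obtain B where "\<forall>x\<in>closure \<Omega>. norm (u x) \<le> B" by (auto simp: bounded_iff)
  moreover have "continuous_on \<Omega> u" using cont closure_subset by (rule continuous_on_subset)
  ultimately show ?thesis
    using assms closure_subset by (intro bounded_measurable_continuous[of _ _ B]) auto
qed

lemma galerkin_hermitian_space:
  fixes \<Omega> :: "(real^'d) set"
  assumes \<Omega>: "open \<Omega>" "bounded \<Omega>" and S: "galerkin_space \<Omega> S"
  shows "hermitian_space cscale S (L2_inner \<Omega>)"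
proof -
  interpret vector_space cscale by (rule vector_space_cscale)
  have L2: "u \<in> L2_space \<Omega>" if "u \<in> S" for u
    using S that by (auto simp: galerkin_space_def H10_space_def H1_space_def)
  show ?thesis
  proof
    show "subspace S" "\<exists>B. finite B \<and> span B = S" using S by (auto simp: galerkin_space_def)
    show "L2_inner \<Omega> \<phi> (u + cscale c w) = L2_inner \<Omega> \<phi> u + c * L2_inner \<Omega> \<phi> w"
      if "\<phi> \<in> S" "u \<in> S" "w \<in> S" for \<phi> u w c
      using L2_inner_linear[OF L2[OF that(1)] L2[OF that(2)] L2[OF that(3)], of c]
      by (simp add: cscale_def plus_fun_def)
    show "L2_inner \<Omega> u w = cnj (L2_inner \<Omega> w u)" for u w by (rule L2_inner_cnj)
    show "0 < Re (L2_inner \<Omega> u u)" if u: "u \<in> S" "u \<noteq> 0" for u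
    proof -
      have "L2_norm \<Omega> u \<noteq> 0"
        using L2_norm_eq_0_AE[OF L2[OF u(1)]] C_closure_eq_0I[OF \<Omega>(1), of u] u S
        by (auto simp: galerkin_space_def)
      then show ?thesis unfolding L2_inner_self by simp
    qed
  qed
qed

section \<open>The Hartree nonlinearity\<close>

text \<open>
  Dominated convergence. Continuity is needed for the measurability of the Hartree term.
\<close>
lemma convolution_potential_continuous:
  fixes \<Omega> :: "(real^'d) set"
  assumes \<Omega>: "open \<Omega>" "bounded \<Omega>" and V: "V \<in> test_functions UNIV" and \<phi>: "bounded_measurable \<Omega> \<phi>"
  shows "continuous_on UNIV (convolution_potential \<Omega> V \<phi>)"
proof (rule continuous_on_sequentiallyI)
  fix s a assume s: "s \<longlonglongrightarrow> (a :: real^'d)"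
  obtain K where K: "K \<ge> 0" "\<And>x. norm (V x) \<le> K" using test_functions_bounded[OF V] by metis
  have Vcont: "continuous_on UNIV V" using test_functions_continuous[OF V] .
  have Vmeas: "(\<lambda>y. complex_of_real (V (x - y))) \<in> borel_measurable (lebesgue_on \<Omega>)" for x
    using \<Omega> by (intro continuous_imp_measurable_on_sets_lebesgue)
      (auto intro!: continuous_intros continuous_on_compose2[OF Vcont])
  show "(\<lambda>n. convolution_potential \<Omega> V \<phi> (s n)) \<longlonglongrightarrow> convolution_potential \<Omega> V \<phi> a"
    unfolding convolution_potential_def
  proof (rule integral_dominated_convergence[where w = "\<lambda>y. K * cmod (\<phi> y)"])
    show "integrable (lebesgue_on \<Omega>) (\<lambda>y. K * cmod (\<phi> y))"
      using bounded_measurable_integrable[OF \<Omega> \<phi>] by simp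
    show "AE y in lebesgue_on \<Omega>. (\<lambda>n. complex_of_real (V (s n - y)) * \<phi> y) \<longlonglongrightarrow> complex_of_real (V (a - y)) * \<phi> y"
    proof (intro AE_I2 tendsto_intros)
      fix y
      have "isCont V (a - y)" using Vcont by (simp add: continuous_on_eq_continuous_at)
      moreover have "(\<lambda>n. s n - y) \<longlonglongrightarrow> a - y" by (intro tendsto_intros s)
      ultimately show "(\<lambda>n. V (s n - y)) \<longlonglongrightarrow> V (a - y)" by (rule isCont_tendsto_compose)
    qed
    show "AE y in lebesgue_on \<Omega>. norm (complex_of_real (V (s n - y)) * \<phi> y) \<le> K * cmod (\<phi> y)" for n
      using K(2) by (intro AE_I2) (simp add: norm_mult mult_right_mono)
  qed (use Vmeas \<phi> in \<open>auto simp: bounded_measurable_def intro!: borel_measurable_times\<close>)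
qed

context
  fixes \<Omega> :: "(real^'d) set" and V lam :: "real^'d \<Rightarrow> real"
  assumes \<Omega>: "open \<Omega>" "bounded \<Omega>" and V: "V \<in> test_functions UNIV"
begin

lemma convolution_integrand_bounded_measurable:
  assumes "bounded_measurable \<Omega> \<phi>"
  shows "bounded_measurable \<Omega> (\<lambda>y. complex_of_real (V (x - y)) * \<phi> y)"
proof -
  obtain K where K: "K \<ge> 0" "\<And>x. norm (V x) \<le> K" using test_functions_bounded[OF V] by metis
  have "continuous_on \<Omega> (\<lambda>y. complex_of_real (V (x - y)))"
    by (auto intro!: continuous_intros continuous_on_compose2[OF test_functions_continuous[OF V, of UNIV]])
  then have "bounded_measurable \<Omega> (\<lambda>y. complex_of_real (V (x - y)))"
    using \<Omega> K by (intro bounded_measurable_continuous[of _ _ K]) auto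
  then show ?thesis using assms by (rule bounded_measurable_mult)
qed

lemma convolution_potential_bound:
  assumes \<phi>: "bounded_measurable \<Omega> \<phi>" and B: "\<And>y. y \<in> \<Omega> \<Longrightarrow> cmod (\<phi> y) \<le> B"
    and K: "\<And>x. \<bar>V x\<bar> \<le> K"
  shows "cmod (convolution_potential \<Omega> V \<phi> x) \<le> K * B * measure lebesgue \<Omega>"
  unfolding convolution_potential_def
proof (rule integral_bound[OF \<Omega> convolution_integrand_bounded_measurable[OF \<phi>]])
  show "cmod (complex_of_real (V (x - y)) * \<phi> y) \<le> K * B" if "y \<in> \<Omega>" for y
    using B[OF that] K[of "x - y"] abs_ge_zero[of "V (x - y)"]
    by (auto simp: norm_mult intro!: mult_mono intro: order_trans)
qed

lemma convolution_potential_diff: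
  assumes "bounded_measurable \<Omega> \<phi>" "bounded_measurable \<Omega> \<psi>"
  shows "convolution_potential \<Omega> V \<phi> x - convolution_potential \<Omega> V \<psi> x =
    convolution_potential \<Omega> V (\<lambda>y. \<phi> y - \<psi> y) x"
  unfolding convolution_potential_def
    Bochner_Integration.integral_diff[symmetric,
      OF bounded_measurable_integrable[OF \<Omega> convolution_integrand_bounded_measurable[OF assms(1)]]
         bounded_measurable_integrable[OF \<Omega> convolution_integrand_bounded_measurable[OF assms(2)]]]
  by (simp add: right_diff_distrib)

lemma bounded_measurable_cmod_sq:
  "bounded_measurable \<Omega> u \<Longrightarrow> bounded_measurable \<Omega> (\<lambda>y. complex_of_real ((cmod (u y))\<^sup>2))"
  unfolding complex_norm_square by (intro bounded_measurable_mult bounded_measurable_cnj)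

lemma bounded_measurable_hartree:
  assumes u: "bounded_measurable \<Omega> u" and lam: "lam \<in> test_functions \<Omega>"
  shows "bounded_measurable \<Omega> (hartree_term \<Omega> lam V u)"
proof -
  note sq = bounded_measurable_cmod_sq[OF u]
  obtain K where K: "\<And>x. \<bar>V x\<bar> \<le> K" using test_functions_bounded[OF V] by (metis real_norm_def)
  obtain L where L: "\<And>x. \<bar>lam x\<bar> \<le> L" using test_functions_bounded[OF lam] by (metis real_norm_def)
  obtain B where B: "\<And>y. y \<in> \<Omega> \<Longrightarrow> cmod (complex_of_real ((cmod (u y))\<^sup>2)) \<le> B"
    using sq unfolding bounded_measurable_def by blast
  have "bounded_measurable \<Omega> (\<lambda>x. complex_of_real (lam x))"
    using \<Omega> L test_functions_continuous[OF lam]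
    by (intro bounded_measurable_continuous[of _ _ L]) (auto intro!: continuous_intros)
  moreover have "bounded_measurable \<Omega> (convolution_potential \<Omega> V (\<lambda>y. complex_of_real ((cmod (u y))\<^sup>2)))"
    using \<Omega> convolution_potential_bound[OF sq B K] convolution_potential_continuous[OF \<Omega> V sq]
    by (intro bounded_measurable_continuous) (auto intro: continuous_on_subset)
  ultimately show ?thesis
    unfolding hartree_term_def[abs_def] by (intro bounded_measurable_mult u)
qed

text \<open>
  The Hartree term is cubic, so its Lipschitz constant grows like the square of the sup norm bound \<open>r\<close>.
  The difference splits into a change of the potential, bounded by a multiple of \<open>2 * r\<^sup>2 * \<delta>\<close> because
  of \<open>\<bar>u\<bar>\<^sup>2 - \<bar>w\<bar>\<^sup>2 = (\<bar>u\<bar> + \<bar>w\<bar>) * (\<bar>u\<bar> - \<bar>w\<bar>)\<close>, and a change of the wave function in a fixed potential,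
  bounded by a multiple of \<open>r\<^sup>2 * \<delta>\<close>.
\<close>
lemma hartree_lipschitz:
  assumes lam: "lam \<in> test_functions \<Omega>"
  obtains H where "H \<ge> 0"
    "\<And>u w r \<delta> x. bounded_measurable \<Omega> u \<Longrightarrow> bounded_measurable \<Omega> w \<Longrightarrow>
        (\<And>y. y \<in> \<Omega> \<Longrightarrow> cmod (u y) \<le> r) \<Longrightarrow> (\<And>y. y \<in> \<Omega> \<Longrightarrow> cmod (w y) \<le> r) \<Longrightarrow>
        (\<And>y. y \<in> \<Omega> \<Longrightarrow> cmod (u y - w y) \<le> \<delta>) \<Longrightarrow> x \<in> \<Omega> \<Longrightarrow>
        cmod (hartree_term \<Omega> lam V u x - hartree_term \<Omega> lam V w x) \<le> H * r\<^sup>2 * \<delta>"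
proof -
  obtain K where K: "K \<ge> 0" "\<And>x. \<bar>V x\<bar> \<le> K" using test_functions_bounded[OF V] by (metis real_norm_def)
  obtain L where L: "L \<ge> 0" "\<And>x. \<bar>lam x\<bar> \<le> L" using test_functions_bounded[OF lam] by (metis real_norm_def)
  define m where "m = measure lebesgue \<Omega>"
  have m: "m \<ge> 0" by (simp add: m_def)
  show thesis
  proof (rule that[of "3 * L * K * m"])
    show "0 \<le> 3 * L * K * m" using K L m by simp
    fix u w r \<delta> x
    assume u: "bounded_measurable \<Omega> u" and w: "bounded_measurable \<Omega> w"
      and ur: "\<And>y. y \<in> \<Omega> \<Longrightarrow> cmod (u y) \<le> r" and wr: "\<And>y. y \<in> \<Omega> \<Longrightarrow> cmod (w y) \<le> r"
      and uw: "\<And>y. y \<in> \<Omega> \<Longrightarrow> cmod (u y - w y) \<le> \<delta>" and x: "x \<in> \<Omega>"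
    define p where "p u x = convolution_potential \<Omega> V (\<lambda>y. complex_of_real ((cmod (u y))\<^sup>2)) x" for u x
    note sq = bounded_measurable_cmod_sq
    have r: "r \<ge> 0" using ur[OF x] norm_ge_zero order_trans by blast
    have \<delta>: "\<delta> \<ge> 0" using uw[OF x] norm_ge_zero order_trans by blast
    have pw: "cmod (p w x) \<le> K * r\<^sup>2 * m"
      unfolding p_def m_def using wr by (intro convolution_potential_bound sq w K) (simp add: power_mono norm_power)
    have "cmod (p u x - p w x) \<le> K * (2 * r * \<delta>) * m"
      unfolding p_def m_def convolution_potential_diff[OF sq[OF u] sq[OF w]]
    proof (intro convolution_potential_bound K)
      show "bounded_measurable \<Omega> (\<lambda>y. complex_of_real ((cmod (u y))\<^sup>2) - complex_of_real ((cmod (w y))\<^sup>2))"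
        by (intro bounded_measurable_diff sq u w)
      show "cmod (complex_of_real ((cmod (u y))\<^sup>2) - complex_of_real ((cmod (w y))\<^sup>2)) \<le> 2 * r * \<delta>"
        if y: "y \<in> \<Omega>" for y
      proof -
        have "cmod (complex_of_real ((cmod (u y))\<^sup>2) - complex_of_real ((cmod (w y))\<^sup>2)) =
            \<bar>(cmod (u y) + cmod (w y)) * (cmod (u y) - cmod (w y))\<bar>"
          by (metis norm_of_real of_real_diff square_diff_square_factored power2_eq_square)
        also have "\<dots> \<le> (2 * r) * \<delta>"
          unfolding abs_mult using ur[OF y] wr[OF y] uw[OF y] norm_triangle_ineq3[of "u y" "w y"] r
          by (intro mult_mono) auto
        finally show ?thesis .
      qed
    qed
    then have puw: "cmod (p u x - p w x) * cmod (u x) \<le> (K * (2 * r * \<delta>) * m) * r"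
      using ur[OF x] K m r \<delta> by (intro mult_mono) auto
    have pwu: "cmod (p w x) * cmod (u x - w x) \<le> (K * r\<^sup>2 * m) * \<delta>"
      using uw[OF x] pw K m r \<delta> by (intro mult_mono) auto
    have "hartree_term \<Omega> lam V u x - hartree_term \<Omega> lam V w x =
        complex_of_real (lam x) * ((p u x - p w x) * u x + p w x * (u x - w x))"
      by (simp add: hartree_term_def p_def algebra_simps)
    also have "cmod \<dots> \<le> L * (cmod (p u x - p w x) * cmod (u x) + cmod (p w x) * cmod (u x - w x))"
      unfolding norm_mult using L
      by (intro mult_mono) (auto intro!: order_trans[OF norm_triangle_ineq] simp: norm_mult)
    also have "\<dots> \<le> L * ((K * (2 * r * \<delta>) * m) * r + (K * r\<^sup>2 * m) * \<delta>)"
      using puw pwu L by (intro mult_left_mono add_mono)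
    also have "\<dots> = 3 * L * K * m * r\<^sup>2 * \<delta>"
      by (simp add: algebra_simps power2_eq_square)
    finally show "cmod (hartree_term \<Omega> lam V u x - hartree_term \<Omega> lam V w x) \<le> 3 * L * K * m * r\<^sup>2 * \<delta>" .
  qed
qed

text \<open>
  The potential of the real density \<open>\<bar>u\<bar>\<^sup>2\<close> is real, so the integrand is real pointwise.
\<close>
lemma hartree_energy_real: "Im (L2_inner \<Omega> u (hartree_term \<Omega> lam V u)) = 0"
proof -
  have real: "convolution_potential \<Omega> V (\<lambda>y. complex_of_real (q y)) x =
      complex_of_real (\<integral>y. V (x - y) * q y \<partial>lebesgue_on \<Omega>)" for q x
    unfolding convolution_potential_def of_real_mult[symmetric] by (rule integral_complex_of_real)
  have "cnj (u x) * hartree_term \<Omega> lam V u x =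
      complex_of_real (lam x * (\<integral>y. V (x - y) * (cmod (u y))\<^sup>2 \<partial>lebesgue_on \<Omega>) * (cmod (u x))\<^sup>2)" for x
    unfolding hartree_term_def real by (simp add: complex_norm_square del: of_real_power)
  then show ?thesis unfolding L2_inner_def by (simp only: integral_complex_of_real Im_complex_of_real)
qed

end

lemma potential_energy_real: "Im (L2_inner \<Omega> u (\<lambda>x. complex_of_real (v x) * u x)) = 0"
proof -
  have "cnj (u x) * (complex_of_real (v x) * u x) = complex_of_real (v x * (cmod (u x))\<^sup>2)" for x
    by (simp add: complex_norm_square del: of_real_power)
  then show ?thesis unfolding L2_inner_def by (simp only: integral_complex_of_real Im_complex_of_real)
qed

text \<open>
  The right-hand side of the weak equation, as a function of the test function and the midpoint.
\<close>
definition hartree_form ::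
    "(real^'d) set \<Rightarrow> (real^'d \<Rightarrow> real) \<Rightarrow> (real^'d \<Rightarrow> real) \<Rightarrow> (real^'d \<Rightarrow> real) \<Rightarrow>
     (real^'d \<Rightarrow> complex) \<Rightarrow> (real^'d \<Rightarrow> complex) \<Rightarrow> complex" where
  "hartree_form \<Omega> v lam V \<phi> u =
     gradient_inner \<Omega> \<phi> u + L2_inner \<Omega> \<phi> (\<lambda>x. complex_of_real (v x) * u x)
     + L2_inner \<Omega> \<phi> (hartree_term \<Omega> lam V u)"

lemma coherent_solution_iff:
  assumes "hermitian_space cscale S (L2_inner \<Omega>)"
  shows "coherent_fully_discrete_solution \<Omega> v lam V S T N \<psi>\<^sub>0 \<Psi> \<longleftrightarrow>
    \<Psi> \<in> {0..N} \<rightarrow>\<^sub>E S \<and> \<Psi> 0 = \<psi>\<^sub>0 \<and>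
    (\<forall>n\<in>{1..N}. hermitian_space.midpoint_step cscale S (L2_inner \<Omega>) (hartree_form \<Omega> v lam V)
        (T / real N) (\<Psi> (n - 1)) (\<Psi> n))"
proof -
  have mid: "midpoint_value \<Psi> n = cscale (1 / 2) (\<Psi> n + \<Psi> (n - 1))" for n
    by (rule ext) (simp add: midpoint_value_def cscale_def)
  have quot: "difference_quotient t \<Psi> n = cscale (of_real (inverse t)) (\<Psi> n - \<Psi> (n - 1))" for n t
    by (rule ext) (simp add: difference_quotient_def cscale_def divide_inverse)
  show ?thesis
    unfolding coherent_fully_discrete_solution_def hermitian_space.midpoint_step_def[OF assms] hartree_form_def
      mid quot by simp
qed

text \<open>
  All three parts of the form are controlled through finite dimension. The gradient form is bounded
  on \<open>S\<close> by a constant depending on \<open>S\<close>. The two other parts are estimated pointwise: on \<open>S\<close> the sup norm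
  over \<open>\<Omega>\<close> is bounded by a multiple \<open>C\<close> of the \<open>L\<^sup>2\<close> norm, and \<open>\<Omega>\<close> has finite measure \<open>m\<close>.
\<close>
lemma hartree_form_lipschitz:
  fixes \<Omega> :: "(real^'d) set"
  assumes \<Omega>: "open \<Omega>" "bounded \<Omega>" and S: "galerkin_space \<Omega> S"
    and v: "v \<in> test_functions \<Omega>" and lam: "lam \<in> test_functions \<Omega>" and V: "V \<in> test_functions UNIV"
    and R: "R \<ge> 0"
  obtains L where "L \<ge> 0"
    "\<And>\<phi> u w. \<phi> \<in> S \<Longrightarrow> u \<in> S \<Longrightarrow> w \<in> S \<Longrightarrow> L2_norm \<Omega> u \<le> R \<Longrightarrow> L2_norm \<Omega> w \<le> R \<Longrightarrow>
       cmod (hartree_form \<Omega> v lam V \<phi> u - hartree_form \<Omega> v lam V \<phi> w)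
         \<le> L * L2_norm \<Omega> \<phi> * L2_norm \<Omega> (u - w)"
proof -
  interpret hermitian_space cscale S "L2_inner \<Omega>" by (rule galerkin_hermitian_space[OF \<Omega> S])
  have nrm: "nrm = L2_norm \<Omega>" by (simp add: fun_eq_iff nrm_def L2_inner_self)
  have SC: "u \<in> C_closure \<Omega>" and SH: "u \<in> H10_space \<Omega>" if "u \<in> S" for u
    using S that by (auto simp: galerkin_space_def)
  have bm: "bounded_measurable \<Omega> u" if "u \<in> S" for u
    using C_closure_bounded_measurable[OF \<Omega> SC[OF that]] .
  have grad_lin: "gradient_inner \<Omega> \<phi> (u + cscale c w) = gradient_inner \<Omega> \<phi> u + c * gradient_inner \<Omega> \<phi> w"
    if "\<phi> \<in> S" "u \<in> S" "w \<in> S" for \<phi> u w c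
    using that by (intro gradient_inner_linear[OF \<Omega>] SH) auto
  obtain G where G: "G \<ge> 0" "\<And>\<phi> u. \<phi> \<in> S \<Longrightarrow> u \<in> S \<Longrightarrow>
      cmod (gradient_inner \<Omega> \<phi> u) \<le> G * L2_norm \<Omega> \<phi> * L2_norm \<Omega> u"
    using sesquilinear_bounded[of "gradient_inner \<Omega>"] grad_lin gradient_inner_cnj unfolding nrm by metis
  \<comment> \<open>the inverse estimate of the sup norm by the \<open>L\<^sup>2\<close> norm: finitely many bounded basis functions\<close>
  obtain C where C: "C \<ge> 0" "\<And>u x. u \<in> S \<Longrightarrow> x \<in> \<Omega> \<Longrightarrow> cmod (u x) \<le> C * L2_norm \<Omega> u"
  proof -
    obtain E where E: "orthonormal E" "\<And>u. u \<in> S \<Longrightarrow> proj E u = u" using orthonormal_basis by auto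
    have "\<exists>b. \<forall>x\<in>\<Omega>. cmod (e x) \<le> b" if "e \<in> E" for e
      using bm[OF orthonormalD(3)[OF E(1) that]] by (simp add: bounded_measurable_def)
    then obtain b where b: "\<And>e x. e \<in> E \<Longrightarrow> x \<in> \<Omega> \<Longrightarrow> cmod (e x) \<le> b e" by metis
    have "cmod (u x) \<le> (\<Sum>e\<in>E. \<bar>b e\<bar>) * L2_norm \<Omega> u" if u: "u \<in> S" and x: "x \<in> \<Omega>" for u x
    proof -
      have "cmod (u x) \<le> (\<Sum>e\<in>E. cmod (e x)) * nrm u"
        by (rule linear_bounded[OF E(1) E(2)[OF u] u]) (simp add: cscale_def)
      also have "\<dots> \<le> (\<Sum>e\<in>E. \<bar>b e\<bar>) * nrm u"
        using b[OF _ x] u by (intro mult_right_mono sum_mono) (auto intro: order_trans[OF _ abs_ge_self])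
      finally show ?thesis by (simp add: nrm)
    qed
    then show thesis using that[of "\<Sum>e\<in>E. \<bar>b e\<bar>"] by (simp add: sum_nonneg)
  qed
  obtain K where K: "K \<ge> 0" "\<And>x. \<bar>v x\<bar> \<le> K" using test_functions_bounded[OF v] by (metis real_norm_def)
  obtain H where H: "H \<ge> 0"
    "\<And>u w r \<delta> x. bounded_measurable \<Omega> u \<Longrightarrow> bounded_measurable \<Omega> w \<Longrightarrow>
        (\<And>y. y \<in> \<Omega> \<Longrightarrow> cmod (u y) \<le> r) \<Longrightarrow> (\<And>y. y \<in> \<Omega> \<Longrightarrow> cmod (w y) \<le> r) \<Longrightarrow>
        (\<And>y. y \<in> \<Omega> \<Longrightarrow> cmod (u y - w y) \<le> \<delta>) \<Longrightarrow> x \<in> \<Omega> \<Longrightarrow>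
        cmod (hartree_term \<Omega> lam V u x - hartree_term \<Omega> lam V w x) \<le> H * r\<^sup>2 * \<delta>"
    using hartree_lipschitz[OF \<Omega> V lam] by metis
  define m where "m = measure lebesgue \<Omega>"
  have m: "m \<ge> 0" by (simp add: m_def)
  have inner_diff: "cmod (L2_inner \<Omega> \<phi> f - L2_inner \<Omega> \<phi> g) \<le> C * L2_norm \<Omega> \<phi> * B * m"
    if \<phi>: "\<phi> \<in> S" and f: "bounded_measurable \<Omega> f" and g: "bounded_measurable \<Omega> g"
      and B: "\<And>x. x \<in> \<Omega> \<Longrightarrow> cmod (f x - g x) \<le> B" for \<phi> f g B
  proof -
    note L2 = L2_space_bounded_measurable[OF \<Omega>]
    have "L2_inner \<Omega> \<phi> f - L2_inner \<Omega> \<phi> g = L2_inner \<Omega> \<phi> (\<lambda>x. f x + (-1) * g x)"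
      using L2_inner_linear[OF L2[OF bm[OF \<phi>]] L2[OF f] L2[OF g], of "-1"] by simp
    also have "\<dots> = (\<integral>x. cnj (\<phi> x) * f x - cnj (\<phi> x) * g x \<partial>lebesgue_on \<Omega>)"
      by (simp add: L2_inner_def algebra_simps)
    also have "cmod \<dots> \<le> C * L2_norm \<Omega> \<phi> * B * m"
      unfolding m_def
    proof (rule integral_bound[OF \<Omega>])
      have "bounded_measurable \<Omega> (\<lambda>x. cnj (\<phi> x) * f x)" "bounded_measurable \<Omega> (\<lambda>x. cnj (\<phi> x) * g x)"
        by (intro bounded_measurable_mult bounded_measurable_cnj bm \<phi> f g)+
      then show "bounded_measurable \<Omega> (\<lambda>x. cnj (\<phi> x) * f x - cnj (\<phi> x) * g x)"
        by (rule bounded_measurable_diff)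
      show "cmod (cnj (\<phi> x) * f x - cnj (\<phi> x) * g x) \<le> C * L2_norm \<Omega> \<phi> * B" if x: "x \<in> \<Omega>" for x
        unfolding right_diff_distrib[symmetric] norm_mult
        using C(2)[OF \<phi> x] B[OF x] C(1) by (intro mult_mono) auto
    qed
    finally show ?thesis .
  qed
  define L where "L = G + C * (K * C) * m + C * (H * (C * R)\<^sup>2 * C) * m"
  show thesis
  proof (rule that[of L])
    show "L \<ge> 0" using G(1) C(1) K(1) H(1) m by (simp add: L_def)
    fix \<phi> u w
    assume \<phi>: "\<phi> \<in> S" and u: "u \<in> S" and w: "w \<in> S" and uR: "L2_norm \<Omega> u \<le> R" and wR: "L2_norm \<Omega> w \<le> R"
    define n where "n = L2_norm \<Omega> (u - w)"
    have sup: "cmod (u y) \<le> C * R" "cmod (w y) \<le> C * R" "cmod (u y - w y) \<le> C * n" if "y \<in> \<Omega>" for y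
      using C(2)[OF u that] C(2)[OF w that] C(2)[OF S_diff[OF u w] that]
        mult_left_mono[OF uR C(1)] mult_left_mono[OF wR C(1)] by (auto simp: n_def)
    have "gradient_inner \<Omega> \<phi> u - gradient_inner \<Omega> \<phi> w = gradient_inner \<Omega> \<phi> (u - w)"
      using grad_lin[OF \<phi> u w, of "-1"] by simp
    then have 1: "cmod (gradient_inner \<Omega> \<phi> u - gradient_inner \<Omega> \<phi> w) \<le> G * L2_norm \<Omega> \<phi> * n"
      using G(2)[OF \<phi> S_diff[OF u w]] by (simp add: n_def)
    have vbm: "bounded_measurable \<Omega> (\<lambda>x. complex_of_real (v x))"
      using \<Omega> K test_functions_continuous[OF v]
      by (intro bounded_measurable_continuous[of _ _ K]) (auto intro!: continuous_intros)
    have 2: "cmod (L2_inner \<Omega> \<phi> (\<lambda>x. complex_of_real (v x) * u x) - L2_inner \<Omega> \<phi> (\<lambda>x. complex_of_real (v x) * w x))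
        \<le> C * L2_norm \<Omega> \<phi> * (K * (C * n)) * m"
    proof (intro inner_diff \<phi> bounded_measurable_mult vbm bm u w)
      fix x assume x: "x \<in> \<Omega>"
      show "cmod (complex_of_real (v x) * u x - complex_of_real (v x) * w x) \<le> K * (C * n)"
        unfolding right_diff_distrib[symmetric] norm_mult
        using sup(3)[OF x] K by (intro mult_mono) auto
    qed
    have 3: "cmod (L2_inner \<Omega> \<phi> (hartree_term \<Omega> lam V u) - L2_inner \<Omega> \<phi> (hartree_term \<Omega> lam V w))
        \<le> C * L2_norm \<Omega> \<phi> * (H * (C * R)\<^sup>2 * (C * n)) * m"
      using sup by (intro inner_diff \<phi> bounded_measurable_hartree \<Omega> V lam bm u w H(2))
    have "hartree_form \<Omega> v lam V \<phi> u - hartree_form \<Omega> v lam V \<phi> w =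
       (gradient_inner \<Omega> \<phi> u - gradient_inner \<Omega> \<phi> w)
       + (L2_inner \<Omega> \<phi> (\<lambda>x. complex_of_real (v x) * u x) - L2_inner \<Omega> \<phi> (\<lambda>x. complex_of_real (v x) * w x))
       + (L2_inner \<Omega> \<phi> (hartree_term \<Omega> lam V u) - L2_inner \<Omega> \<phi> (hartree_term \<Omega> lam V w))"
      by (simp add: hartree_form_def)
    also have "cmod \<dots> \<le> G * L2_norm \<Omega> \<phi> * n + C * L2_norm \<Omega> \<phi> * (K * (C * n)) * m
        + C * L2_norm \<Omega> \<phi> * (H * (C * R)\<^sup>2 * (C * n)) * m"
      by (intro norm_triangle_le add_mono 1 2 3)
    also have "\<dots> = L * L2_norm \<Omega> \<phi> * L2_norm \<Omega> (u - w)"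
      unfolding n_def[symmetric] by (simp add: L_def algebra_simps)
    finally show "cmod (hartree_form \<Omega> v lam V \<phi> u - hartree_form \<Omega> v lam V \<phi> w)
         \<le> L * L2_norm \<Omega> \<phi> * L2_norm \<Omega> (u - w)" .
  qed
qed

lemma hartree_form_antilinear:
  fixes \<Omega> :: "(real^'d) set"
  assumes \<Omega>: "open \<Omega>" "bounded \<Omega>" and S: "galerkin_space \<Omega> S"
    and v: "v \<in> test_functions \<Omega>" and lam: "lam \<in> test_functions \<Omega>" and V: "V \<in> test_functions UNIV"
    and mem: "u \<in> S" "w \<in> S" "\<xi> \<in> S"
  shows "hartree_form \<Omega> v lam V (u + cscale c w) \<xi> =
     hartree_form \<Omega> v lam V u \<xi> + cnj c * hartree_form \<Omega> v lam V w \<xi>"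
proof -
  interpret hermitian_space cscale S "L2_inner \<Omega>" by (rule galerkin_hermitian_space[OF \<Omega> S])
  have bm: "bounded_measurable \<Omega> u" if "u \<in> S" for u
    using C_closure_bounded_measurable[OF \<Omega>] S that by (auto simp: galerkin_space_def)
  have SH: "u \<in> H10_space \<Omega>" if "u \<in> S" for u
    using S that by (auto simp: galerkin_space_def)
  have "gradient_inner \<Omega> \<xi> (u + cscale c w) = gradient_inner \<Omega> \<xi> u + c * gradient_inner \<Omega> \<xi> w"
    using mem by (intro gradient_inner_linear[OF \<Omega>] SH) auto
  then have grad: "gradient_inner \<Omega> (u + cscale c w) \<xi> = gradient_inner \<Omega> u \<xi> + cnj c * gradient_inner \<Omega> w \<xi>"
    using gradient_inner_cnj[of \<Omega> _ \<xi>] by simp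
  have inner: "L2_inner \<Omega> (u + cscale c w) f = L2_inner \<Omega> u f + cnj c * L2_inner \<Omega> w f"
    if f: "bounded_measurable \<Omega> f" for f
  proof -
    note L2 = L2_space_bounded_measurable[OF \<Omega>]
    have "L2_inner \<Omega> f (\<lambda>x. u x + c * w x) = L2_inner \<Omega> f u + c * L2_inner \<Omega> f w"
      by (intro L2_inner_linear L2 f bm mem)
    moreover have "u + cscale c w = (\<lambda>x. u x + c * w x)" by (simp add: fun_eq_iff cscale_def)
    ultimately show ?thesis using L2_inner_cnj[of \<Omega> _ f] by simp
  qed
  obtain K where "\<And>x. norm (v x) \<le> K" using test_functions_bounded[OF v] by metis
  then have vbm: "bounded_measurable \<Omega> (\<lambda>x. complex_of_real (v x))"
    using \<Omega> test_functions_continuous[OF v]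
    by (intro bounded_measurable_continuous[of _ _ K]) (auto intro!: continuous_intros)
  show ?thesis
    unfolding hartree_form_def grad inner[OF bounded_measurable_mult[OF vbm bm[OF mem(3)]]]
      inner[OF bounded_measurable_hartree[OF \<Omega> V bm[OF mem(3)] lam]]
    by (simp add: algebra_simps)
qed

section \<open>The discrete Hartree problem\<close>

theorem theorem29:
  fixes \<Omega> :: "(real^'d) set"
    and v lam V :: "real^'d \<Rightarrow> real"
    and S :: "real \<Rightarrow> (real^'d \<Rightarrow> complex) set"
    and C\<^sub>B T h :: real
    and \<psi>\<^sub>0 :: "real^'d \<Rightarrow> complex"
  assumes "smooth_bounded_domain \<Omega>"
    and "v \<in> test_functions \<Omega>" and "lam \<in> test_functions \<Omega>" and "V \<in> test_functions UNIV"
    and "\<And>h. h \<in> {0<..<1} \<Longrightarrow> galerkin_space \<Omega> (S h)"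
    and "C\<^sub>B > 0"
    and "\<And>h \<phi>. h \<in> {0<..<1} \<Longrightarrow> \<phi> \<in> S h \<Longrightarrow> H1_norm \<Omega> \<phi> \<le> C\<^sub>B * inverse h * L2_norm \<Omega> \<phi>"
    and "T > 0" and "h \<in> {0<..<1}" and "\<psi>\<^sub>0 \<in> S h"
  shows "\<exists>\<tau>\<^sub>0>0. \<forall>N::nat. N \<ge> 1 \<longrightarrow> T / real N \<le> \<tau>\<^sub>0 \<longrightarrow>
           (\<exists>!\<Psi>. coherent_fully_discrete_solution \<Omega> v lam V (S h) T N \<psi>\<^sub>0 \<Psi>)"
proof -
  have \<Omega>: "open \<Omega>" "bounded \<Omega>" using assms(1) by (auto simp: smooth_bounded_domain_def)
  have S: "galerkin_space \<Omega> (S h)" using assms by blast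
  have herm: "hermitian_space cscale (S h) (L2_inner \<Omega>)" by (rule galerkin_hermitian_space[OF \<Omega> S])
  interpret hermitian_space cscale "S h" "L2_inner \<Omega>" by (rule herm)
  have nrm: "nrm = L2_norm \<Omega>" by (simp add: fun_eq_iff nrm_def L2_inner_self)
  define F where "F = hartree_form \<Omega> v lam V"
  \<comment> \<open>by conservation of mass one radius serves all time steps, so one bound on \<open>\<tau>\<close> does as well\<close>
  define R where "R = nrm \<psi>\<^sub>0 + 1"
  have R: "R \<ge> 1" using assms(10) by (simp add: R_def)
  obtain L where L: "L \<ge> 0"
    "\<And>\<phi> u w. \<phi> \<in> S h \<Longrightarrow> u \<in> S h \<Longrightarrow> w \<in> S h \<Longrightarrow> nrm u \<le> R \<Longrightarrow> nrm w \<le> R \<Longrightarrow>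
       cmod (F \<phi> u - F \<phi> w) \<le> L * nrm \<phi> * nrm (u - w)"
    using hartree_form_lipschitz[OF \<Omega> S assms(2-4) order_trans[OF zero_le_one R]]
    unfolding nrm F_def by blast
  have anti: "F (u + cscale c w) \<xi> = F u \<xi> + cnj c * F w \<xi>"
    if "u \<in> S h" "w \<in> S h" "\<xi> \<in> S h" for u w \<xi> c
    unfolding F_def by (rule hartree_form_antilinear[OF \<Omega> S assms(2-4) that])
  have real: "Im (F u u) = 0" for u
    by (simp add: F_def hartree_form_def gradient_inner_self_real potential_energy_real
        hartree_energy_real[OF \<Omega> assms(4)])
  have zero: "F \<phi> 0 = 0" if \<phi>: "\<phi> \<in> S h" for \<phi>
  proof -
    have "gradient_inner \<Omega> \<phi> (0 + cscale 1 0) = gradient_inner \<Omega> \<phi> 0 + 1 * gradient_inner \<Omega> \<phi> 0"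
      using \<phi> S S_zero by (intro gradient_inner_linear[OF \<Omega>]) (auto simp: galerkin_space_def)
    then show ?thesis
      by (simp add: F_def hartree_form_def L2_inner_def hartree_term_def)
  qed
  \<comment> \<open>the summand 1 avoids a division by zero when \<open>L = 0\<close>\<close>
  define \<tau>\<^sub>0 where "\<tau>\<^sub>0 = 1 / (L * R + 1)"
  have pos: "L * R + 1 > 0" using L(1) R by (simp add: add_nonneg_pos)
  show ?thesis
  proof (intro exI[of _ \<tau>\<^sub>0] conjI allI impI)
    show "\<tau>\<^sub>0 > 0" using pos by (simp add: \<tau>\<^sub>0_def)
    fix N :: nat assume N: "N \<ge> 1" and le: "T / real N \<le> \<tau>\<^sub>0"
    define \<tau> where "\<tau> = T / real N"
    have \<tau>: "\<tau> > 0" using N assms(8) by (simp add: \<tau>_def)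
    have "\<tau> * (L * R + 1) \<le> 1" using le pos by (simp add: \<tau>_def[symmetric] \<tau>\<^sub>0_def pos_le_divide_eq)
    then have \<tau>L: "\<tau> * L * R \<le> 1" using \<tau> by (simp add: algebra_simps)
    show "\<exists>!\<Psi>. coherent_fully_discrete_solution \<Omega> v lam V (S h) T N \<psi>\<^sub>0 \<Psi>"
      unfolding coherent_solution_iff[OF herm] \<tau>_def[symmetric] F_def[symmetric]
    proof (rule ex1_iterated_tuple[of "\<lambda>p. p \<in> S h \<and> nrm p = nrm \<psi>\<^sub>0"])
      show "\<exists>!u. u \<in> S h \<and> midpoint_step F \<tau> p u" if "p \<in> S h \<and> nrm p = nrm \<psi>\<^sub>0" for p
        using that by (intro midpoint_step_ex1[where R = R and L = L] anti real zero L \<tau> \<tau>L) (auto simp: R_def)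
      show "u \<in> S h \<and> nrm u = nrm \<psi>\<^sub>0"
        if "p \<in> S h \<and> nrm p = nrm \<psi>\<^sub>0" "u \<in> S h" "midpoint_step F \<tau> p u" for p u
        using midpoint_step_nrm[of p u \<tau> F] that \<tau> real by simp
    qed (use assms in auto)
  qed
qed

end
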